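(* Let $\omega=\omega_{(p)}$ be the state on the Cuntz algebra $\mathcal{O}_d$ ($2\le d<\infty$) with $\omega(s_\alpha s_\gamma^* )=\delta_{\alpha\gamma}p^\alpha$, and let $\mathcal{H}_{\Omega_0}$ be the cyclic space of the associated $\mathcal{O}_d$-representation. Let $\mathcal{M}(\mathbb{Z}_d)$ be the set of all multi-indices formed from $\mathbb{Z}_d=\{1,\dots,d\}$. Then $\mathcal{H}_{\Omega_0}$ is fibered (as a Hilbert space) over $\mathcal{M}(\mathbb{Z}_d)$, and the fiber over each $\alpha$ in $\mathcal{M}(\mathbb{Z}_d)$ is a copy of $\mathcal{H}_-$.
   Context: $\mathcal{O}_d$ is generated by $s_1,\dots,s_d$ with $s_i^*s_j=\delta_{ij}1$, $\sum_i s_is_i^*=1$. Weights: $p_i>0$, $\sum_{i=1}^d p_i=1$; for a finite multi-index $\alpha=(\alpha_1\dots\alpha_k)$, $s_\alpha=s_{\alpha_1}\cdots s_{\alpha_k}$ and $p^\alpha=p_{\alpha_1}\cdots p_{\alpha_k}$ (with $p^{\text{ø}}=1$ for the empty multi-index ø, which belongs to $\mathcal{M}(\mathbb{Z}_d)$). $\mu$ is the $(p_i)$-product measure on $\Omega=\prod_1^\infty\{1,\dots,d\}$, $\sigma$ is the shift $\sigma(x_1,x_2,\dots)=(x_2,x_3,\dots)$. $\mathbb{F}_d$ is the free group on generators $g_1,\dots,g_d$, $\lambda$ its left regular representation on $\ell^2(\mathbb{F}_d)$ with orthonormal basis $\{\xi_g\}$, $e$ the neutral element, $g_\alpha=g_{\alpha_1}\cdots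 g_{\alpha_k}$, and $\mathbb{S}_d\subset\mathbb{F}_d$ the free semigroup of all $g_\alpha$ (including $e$). $\mathcal{H}_-$ is the closed linear span in $\ell^2(\mathbb{F}_d)$ of $\{\lambda(s^{-1})\xi_e\mid s\in\mathbb{S}_d\}$. The representation is realized on $L^2(\Omega,\mu)\otimes\ell^2(\mathbb{F}_d)$, viewed as $\ell^2(\mathbb{F}_d)$-valued functions on $\Omega$, by $s_i\mapsto T_i$, $(T_i\xi)(x)=p_i^{-1/2}\delta_{i,x_1}\lambda(g_i)\xi(\sigma(x))$, and $\mathcal{H}_{\Omega_0}$ is the closed cyclic subspace generated by $\Omega_0=1\otimes\xi_e$ (whose vector state is $\omega$). Definition: a Hilbert space $\mathcal{H}$ is fibered over a set $\mathcal{M}$ with fibers isomorphic to a Hilbert space $\mathcal{K}$ if there are isometries $i_\alpha:\mathcal{K}\to\mathcal{H}$, indexed by $\alpha\in\mathcal{M}$, such that $\mathcal{H}$ is the closed linear span of $\{i_\alpha(\mathcal{K})\mid\alpha\in\mathcal{M}\}$. *)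

theory Defs
  imports "HOL-Probability.Probability" "HOL-Algebra.Group"
begin

section \<open>Complex Hilbert spaces with explicit carrier\<close>

text \<open>
  The space \<open>L\<^sup>2(\<Omega>,\<mu>)\<close> depends on the weights, so Hilbert spaces are records with
  a carrier rather than types. Inner products are linear in the second argument.
\<close>

record 'h hilb =
  hcarrier :: "'h set"
  hadd :: "'h \<Rightarrow> 'h \<Rightarrow> 'h"
  hzero :: 'h
  hscale :: "complex \<Rightarrow> 'h \<Rightarrow> 'h"
  hinner :: "'h \<Rightarrow> 'h \<Rightarrow> complex"

definition hnorm :: "'h hilb \<Rightarrow> 'h \<Rightarrow> real" where
  "hnorm H x = sqrt (Re (hinner H x x))"

definition hdist :: "'h hilb \<Rightarrow> 'h \<Rightarrow> 'h \<Rightarrow> real" where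
  "hdist H x y = hnorm H (hadd H x (hscale H (-1) y))"

locale complex_hilbert_space =
  fixes H :: "'h hilb"
  assumes add_closed: "\<lbrakk>x \<in> hcarrier H; y \<in> hcarrier H\<rbrakk> \<Longrightarrow> hadd H x y \<in> hcarrier H"
    and zero_closed: "hzero H \<in> hcarrier H"
    and scale_closed: "x \<in> hcarrier H \<Longrightarrow> hscale H c x \<in> hcarrier H"
    and add_assoc: "\<lbrakk>x \<in> hcarrier H; y \<in> hcarrier H; z \<in> hcarrier H\<rbrakk> \<Longrightarrow>
          hadd H (hadd H x y) z = hadd H x (hadd H y z)"
    and add_commute: "\<lbrakk>x \<in> hcarrier H; y \<in> hcarrier H\<rbrakk> \<Longrightarrow> hadd H x y = hadd H y x"
    and add_zero: "x \<in> hcarrier H \<Longrightarrow> hadd H x (hzero H) = x"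
    and add_inverse: "x \<in> hcarrier H \<Longrightarrow> hadd H x (hscale H (-1) x) = hzero H"
    and scale_add_right: "\<lbrakk>x \<in> hcarrier H; y \<in> hcarrier H\<rbrakk> \<Longrightarrow>
          hscale H c (hadd H x y) = hadd H (hscale H c x) (hscale H c y)"
    and scale_add_left: "x \<in> hcarrier H \<Longrightarrow>
          hscale H (c + c') x = hadd H (hscale H c x) (hscale H c' x)"
    and scale_scale: "x \<in> hcarrier H \<Longrightarrow> hscale H c (hscale H c' x) = hscale H (c * c') x"
    and scale_one: "x \<in> hcarrier H \<Longrightarrow> hscale H 1 x = x"
    and inner_commute: "\<lbrakk>x \<in> hcarrier H; y \<in> hcarrier H\<rbrakk> \<Longrightarrow> hinner H x y = cnj (hinner H y x)"
    and inner_add_right: "\<lbrakk>x \<in> hcarrier H; y \<in> hcarrier H; z \<in> hcarrier H\<rbrakk> \<Longrightarrow>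
          hinner H x (hadd H y z) = hinner H x y + hinner H x z"
    and inner_scale_right: "\<lbrakk>x \<in> hcarrier H; y \<in> hcarrier H\<rbrakk> \<Longrightarrow>
          hinner H x (hscale H c y) = c * hinner H x y"
    and inner_nonneg: "x \<in> hcarrier H \<Longrightarrow> 0 \<le> Re (hinner H x x)"
    and inner_definite: "\<lbrakk>x \<in> hcarrier H; hinner H x x = 0\<rbrakk> \<Longrightarrow> x = hzero H"
    and complete: "\<lbrakk>\<And>n::nat. X n \<in> hcarrier H;
          \<forall>e>0. \<exists>N. \<forall>m\<ge>N. \<forall>n\<ge>N. hdist H (X m) (X n) < e\<rbrakk> \<Longrightarrow>
          \<exists>l\<in>hcarrier H. (\<lambda>n. hdist H (X n) l) \<longlonglongrightarrow> 0"

definition hsubspace :: "'h hilb \<Rightarrow> 'h set \<Rightarrow> bool" where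
  "hsubspace H V \<longleftrightarrow> V \<subseteq> hcarrier H \<and> hzero H \<in> V \<and>
     (\<forall>x\<in>V. \<forall>y\<in>V. hadd H x y \<in> V) \<and> (\<forall>c. \<forall>x\<in>V. hscale H c x \<in> V)"

definition hspan :: "'h hilb \<Rightarrow> 'h set \<Rightarrow> 'h set" where
  "hspan H S = \<Inter>{V. hsubspace H V \<and> S \<subseteq> V}"

definition hclosure :: "'h hilb \<Rightarrow> 'h set \<Rightarrow> 'h set" where
  "hclosure H S = {x \<in> hcarrier H. \<forall>e>0. \<exists>y\<in>S. hdist H x y < e}"

definition closed_span :: "'h hilb \<Rightarrow> 'h set \<Rightarrow> 'h set" where
  "closed_span H S = hclosure H (hspan H S)"

definition hrestrict :: "'h hilb \<Rightarrow> 'h set \<Rightarrow> 'h hilb" where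
  "hrestrict H V = H\<lparr>hcarrier := V\<rparr>"

definition hlinear :: "'k hilb \<Rightarrow> 'h hilb \<Rightarrow> ('k \<Rightarrow> 'h) \<Rightarrow> bool" where
  "hlinear K H f \<longleftrightarrow>
     (\<forall>x\<in>hcarrier K. f x \<in> hcarrier H) \<and>
     (\<forall>x\<in>hcarrier K. \<forall>y\<in>hcarrier K. f (hadd K x y) = hadd H (f x) (f y)) \<and>
     (\<forall>c. \<forall>x\<in>hcarrier K. f (hscale K c x) = hscale H c (f x))"

definition hisometry :: "'k hilb \<Rightarrow> 'h hilb \<Rightarrow> ('k \<Rightarrow> 'h) \<Rightarrow> bool" where
  "hisometry K H f \<longleftrightarrow> hlinear K H f \<and> (\<forall>x\<in>hcarrier K. hnorm H (f x) = hnorm K x)"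

definition hbounded_op :: "'h hilb \<Rightarrow> ('h \<Rightarrow> 'h) \<Rightarrow> bool" where
  "hbounded_op H f \<longleftrightarrow> hlinear H H f \<and> (\<exists>C. \<forall>x\<in>hcarrier H. hnorm H (f x) \<le> C * hnorm H x)"

definition fibered_over :: "'h hilb \<Rightarrow> 'm set \<Rightarrow> 'k hilb \<Rightarrow> bool" where
  "fibered_over H M K \<longleftrightarrow>
     complex_hilbert_space H \<and> complex_hilbert_space K \<and>
     (\<exists>i. (\<forall>\<alpha>\<in>M. hisometry K H (i \<alpha>)) \<and>
          hcarrier H = closed_span H (\<Union>\<alpha>\<in>M. i \<alpha> ` hcarrier K))"

section \<open>The concrete spaces\<close>

definition ell2 :: "'g set \<Rightarrow> ('g \<Rightarrow> complex) hilb" where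
  "ell2 I = \<lparr>
     hcarrier = {f. (\<forall>g. g \<notin> I \<longrightarrow> f g = 0) \<and> (\<lambda>g. (cmod (f g))\<^sup>2) summable_on I},
     hadd = (\<lambda>f f' g. f g + f' g),
     hzero = (\<lambda>g. 0),
     hscale = (\<lambda>c f g. c * f g),
     hinner = (\<lambda>f f'. \<Sum>\<^sub>\<infinity>g\<in>I. cnj (f g) * f' g)\<rparr>"

definition ket :: "'g \<Rightarrow> 'g \<Rightarrow> complex" where
  "ket g = (\<lambda>h. if h = g then 1 else 0)"

text \<open>
  \<open>L\<^sup>2\<close>-functions with values in a Hilbert space \<open>K\<close>. Measurability is weak measurability, which
  for separable \<open>K\<close> is the same as strong measurability. Elements of the space are classes
  of functions that agree almost everywhere.
\<close>

definition sq_int :: "'x measure \<Rightarrow> 'k hilb \<Rightarrow> ('x \<Rightarrow> 'k) set" where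
  "sq_int M K = {\<xi>. (\<forall>x\<in>space M. \<xi> x \<in> hcarrier K) \<and>
     (\<forall>k\<in>hcarrier K. (\<lambda>x. hinner K k (\<xi> x)) \<in> borel_measurable M) \<and>
     integrable M (\<lambda>x. (hnorm K (\<xi> x))\<^sup>2)}"

definition ae_class :: "'x measure \<Rightarrow> 'k hilb \<Rightarrow> ('x \<Rightarrow> 'k) \<Rightarrow> ('x \<Rightarrow> 'k) set" where
  "ae_class M K \<xi> = {\<eta> \<in> sq_int M K. AE x in M. \<eta> x = \<xi> x}"

definition rep :: "('x \<Rightarrow> 'k) set \<Rightarrow> 'x \<Rightarrow> 'k" where
  "rep X = (SOME \<xi>. \<xi> \<in> X)"

definition L2 :: "'x measure \<Rightarrow> 'k hilb \<Rightarrow> ('x \<Rightarrow> 'k) set hilb" where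
  "L2 M K = \<lparr>
     hcarrier = ae_class M K ` sq_int M K,
     hadd = (\<lambda>X Y. ae_class M K (\<lambda>x. hadd K (rep X x) (rep Y x))),
     hzero = ae_class M K (\<lambda>x. hzero K),
     hscale = (\<lambda>c X. ae_class M K (\<lambda>x. hscale K c (rep X x))),
     hinner = (\<lambda>X Y. \<integral>x. hinner K (rep X x) (rep Y x) \<partial>M)\<rparr>"

section \<open>The free group and its regular representation\<close>

text \<open>Words in the letters \<open>(i, True) = g\<^sub>i\<close> and \<open>(i, False) = g\<^sub>i\<^sup>-\<^sup>1\<close>.\<close>

type_synonym 'i fword = "('i \<times> bool) list"

fun cancels :: "'i \<times> bool \<Rightarrow> 'i \<times> bool \<Rightarrow> bool" where
  "cancels (i, b) (j, c) \<longleftrightarrow> i = j \<and> b \<noteq> c"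

fun rcons :: "'i \<times> bool \<Rightarrow> 'i fword \<Rightarrow> 'i fword" where
  "rcons a [] = [a]"
| "rcons a (b # w) = (if cancels a b then w else a # b # w)"

definition free_group :: "'i set \<Rightarrow> 'i fword monoid" where
  "free_group I = \<lparr>
     carrier = {w. set w \<subseteq> I \<times> UNIV \<and> successively (\<lambda>a b. \<not> cancels a b) w},
     monoid.mult = (\<lambda>u v. foldr rcons u v),
     one = []\<rparr>"

lemma successively_rcons:
  "successively (\<lambda>a b. \<not> cancels a b) w \<Longrightarrow> successively (\<lambda>a b. \<not> cancels a b) (rcons a w)"
  by (cases w) (auto simp: successively_Cons)

lemma rcons_cancel:
  assumes "successively (\<lambda>a b. \<not> cancels a b) w"
  shows "rcons (i, b) (rcons (i, \<not> b) w) = w"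
proof (cases w)
  case (Cons c u)
  obtain j e where c: "c = (j, e)" by (cases c)
  show ?thesis using assms Cons c
    by (cases u) auto
qed simp

lemma successively_foldr_rcons:
  "successively (\<lambda>a b. \<not> cancels a b) v \<Longrightarrow>
    successively (\<lambda>a b. \<not> cancels a b) (foldr rcons u v)"
  by (induction u) (auto intro: successively_rcons)

lemma set_rcons: "set (rcons a w) \<subseteq> insert a (set w)"
  by (cases w) auto

lemma set_foldr_rcons: "set (foldr rcons u v) \<subseteq> set u \<union> set v"
  by (induction u) (use set_rcons in fastforce)+

lemma foldr_rcons_reduced:
  "successively (\<lambda>a b. \<not> cancels a b) u \<Longrightarrow> foldr rcons u [] = u"
proof (induction u)
  case (Cons a u)
  then show ?case by (cases u) (auto simp: successively_Cons)
qed simp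

lemma foldr_rcons_rcons:
  assumes "successively (\<lambda>a b. \<not> cancels a b) w"
  shows "foldr rcons (rcons a u) w = rcons a (foldr rcons u w)"
proof (cases u)
  case (Cons c u')
  obtain i b j e where ac: "a = (i, b)" "c = (j, e)" by (cases a; cases c)
  show ?thesis
  proof (cases "cancels a c")
    case True
    then have "c = (i, \<not> b)" using ac by auto
    then show ?thesis
      using Cons ac True rcons_cancel[OF successively_foldr_rcons[OF assms]] by simp
  qed (use Cons in simp)
qed simp

lemma foldr_rcons_assoc:
  assumes "successively (\<lambda>a b. \<not> cancels a b) w"
  shows "foldr rcons (foldr rcons u v) w = foldr rcons u (foldr rcons v w)"
  by (induction u) (simp_all add: foldr_rcons_rcons[OF assms])

lemma group_free_group: "group (free_group I)"
proof (rule groupI)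
  fix u assume u: "u \<in> carrier (free_group I)"
  have red: "foldr rcons (rev (map (\<lambda>(i, b). (i, \<not> b)) u)) (foldr rcons u []) = []"
    for u :: "'a fword"
  proof (induction u)
    case (Cons a u)
    obtain i b where a: "a = (i, b)" by (cases a)
    have "rcons (i, \<not> b) (rcons (i, b) (foldr rcons u [])) = foldr rcons u []"
      using rcons_cancel[OF successively_foldr_rcons, of "[]" i "\<not> b" u] by simp
    then show ?case using Cons a by simp
  qed simp
  let ?u = "foldr rcons (rev (map (\<lambda>(i, b). (i, \<not> b)) u)) []"
  have "successively (\<lambda>a b. \<not> cancels a b) ?u" by (simp add: successively_foldr_rcons)
  moreover have "set ?u \<subseteq> I \<times> UNIV"
    using set_foldr_rcons[of "rev (map (\<lambda>(i, b). (i, \<not> b)) u)" "[]"] u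
    by (force simp: free_group_def)
  moreover have "foldr rcons ?u u = []"
    using u red[of u] by (simp add: free_group_def foldr_rcons_assoc foldr_rcons_reduced)
  ultimately show "\<exists>v\<in>carrier (free_group I). v \<otimes>\<^bsub>free_group I\<^esub> u = \<one>\<^bsub>free_group I\<^esub>"
    by (intro bexI[of _ ?u]) (simp_all add: free_group_def)
next
  fix u v assume "u \<in> carrier (free_group I)" "v \<in> carrier (free_group I)"
  then show "u \<otimes>\<^bsub>free_group I\<^esub> v \<in> carrier (free_group I)"
    using set_foldr_rcons[of u v] by (auto simp: free_group_def successively_foldr_rcons)
qed (auto simp: free_group_def foldr_rcons_assoc)

definition gen :: "'i \<Rightarrow> 'i fword" where
  "gen i = [(i, True)]"

abbreviation Fd :: "nat \<Rightarrow> nat fword monoid" where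
  "Fd d \<equiv> free_group {1..d}"

definition gword :: "nat \<Rightarrow> nat list \<Rightarrow> nat fword" where
  "gword d \<alpha> = foldr (\<lambda>i w. gen i \<otimes>\<^bsub>Fd d\<^esub> w) \<alpha> \<one>\<^bsub>Fd d\<^esub>"

definition free_semigroup :: "nat \<Rightarrow> nat fword set" where
  "free_semigroup d = gword d ` lists {1..d}"

definition left_reg :: "'g monoid \<Rightarrow> 'g \<Rightarrow> ('g \<Rightarrow> complex) \<Rightarrow> 'g \<Rightarrow> complex" where
  "left_reg G g f = (\<lambda>h. if h \<in> carrier G then f (inv\<^bsub>G\<^esub> g \<otimes>\<^bsub>G\<^esub> h) else 0)"

definition H_minus :: "nat \<Rightarrow> (nat fword \<Rightarrow> complex) hilb" where
  "H_minus d = hrestrict (ell2 (carrier (Fd d)))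
     (closed_span (ell2 (carrier (Fd d)))
       {left_reg (Fd d) (inv\<^bsub>Fd d\<^esub> s) (ket \<one>\<^bsub>Fd d\<^esub>) | s. s \<in> free_semigroup d})"

section \<open>The realization on \<open>L\<^sup>2(\<Omega>,\<mu>) \<otimes> \<ell>\<^sup>2(\<bbbF>\<^sub>d)\<close>\<close>

text \<open>Sequences in \<open>\<Omega>\<close> are indexed from \<open>0\<close>, so that \<open>x 0\<close> is the first letter of \<open>x\<close>.\<close>

definition prod_measure :: "nat \<Rightarrow> (nat \<Rightarrow> real) \<Rightarrow> (nat \<Rightarrow> nat) measure" where
  "prod_measure d p = PiM UNIV (\<lambda>_. point_measure {1..d} (\<lambda>i. ennreal (p i)))"

definition shift :: "(nat \<Rightarrow> nat) \<Rightarrow> nat \<Rightarrow> nat" where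
  "shift x = (\<lambda>n. x (Suc n))"

type_synonym vec = "((nat \<Rightarrow> nat) \<Rightarrow> nat fword \<Rightarrow> complex) set"

definition big_space :: "nat \<Rightarrow> (nat \<Rightarrow> real) \<Rightarrow> vec hilb" where
  "big_space d p = L2 (prod_measure d p) (ell2 (carrier (Fd d)))"

definition T_op :: "nat \<Rightarrow> (nat \<Rightarrow> real) \<Rightarrow> nat \<Rightarrow> vec \<Rightarrow> vec" where
  "T_op d p i X = ae_class (prod_measure d p) (ell2 (carrier (Fd d)))
     (\<lambda>x g. of_real (p i powr (-1/2)) * (if x 0 = i then 1 else 0) *
       left_reg (Fd d) (gen i) (rep X (shift x)) g)"

definition Omega0 :: "nat \<Rightarrow> (nat \<Rightarrow> real) \<Rightarrow> vec" where
  "Omega0 d p = ae_class (prod_measure d p) (ell2 (carrier (Fd d))) (\<lambda>x. ket \<one>\<^bsub>Fd d\<^esub>)"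

section \<open>C*-algebras, states, representations\<close>

text \<open>Unital complex C*-algebras, with involution \<open>adj\<close>.\<close>

class cstar_algebra = real_normed_algebra_1 + banach +
  fixes scaleC :: "complex \<Rightarrow> 'a \<Rightarrow> 'a"
    and adj :: "'a \<Rightarrow> 'a"
  assumes scaleC_add_right: "scaleC c (x + y) = scaleC c x + scaleC c y"
    and scaleC_add_left: "scaleC (c + c') x = scaleC c x + scaleC c' x"
    and scaleC_scaleC: "scaleC c (scaleC c' x) = scaleC (c * c') x"
    and scaleC_of_real: "scaleC (complex_of_real r) x = r *\<^sub>R x"
    and scaleC_mult_left: "scaleC c x * y = scaleC c (x * y)"
    and scaleC_mult_right: "x * scaleC c y = scaleC c (x * y)"
    and norm_scaleC: "norm (scaleC c x) = cmod c * norm x"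
    and adj_add: "adj (x + y) = adj x + adj y"
    and adj_scaleC: "adj (scaleC c x) = scaleC (cnj c) (adj x)"
    and adj_mult: "adj (x * y) = adj y * adj x"
    and adj_adj: "adj (adj x) = x"
    and cstar_identity: "norm (adj x * x) = (norm x)\<^sup>2"

definition cstar_subalgebra :: "'a::cstar_algebra set \<Rightarrow> bool" where
  "cstar_subalgebra B \<longleftrightarrow> closed B \<and> 1 \<in> B \<and>
     (\<forall>x\<in>B. \<forall>y\<in>B. x + y \<in> B \<and> x * y \<in> B) \<and>
     (\<forall>c. \<forall>x\<in>B. scaleC c x \<in> B) \<and> (\<forall>x\<in>B. adj x \<in> B)"

text \<open>
  The algebra is \<open>\<O>\<^sub>d\<close> with canonical generators \<open>s 1, \<dots>, s d\<close>. No universal property is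
  required, since for \<open>d \<ge> 2\<close> the relations determine the generated algebra up to isomorphism.
\<close>

definition cuntz_generators :: "nat \<Rightarrow> (nat \<Rightarrow> 'a::cstar_algebra) \<Rightarrow> bool" where
  "cuntz_generators d s \<longleftrightarrow>
     (\<forall>i\<in>{1..d}. \<forall>j\<in>{1..d}. adj (s i) * s j = (if i = j then 1 else 0)) \<and>
     (\<Sum>i=1..d. s i * adj (s i)) = 1 \<and>
     (\<forall>B. cstar_subalgebra B \<and> s ` {1..d} \<subseteq> B \<longrightarrow> B = UNIV)"

definition is_state :: "('a::cstar_algebra \<Rightarrow> complex) \<Rightarrow> bool" where
  "is_state \<omega> \<longleftrightarrow>
     (\<forall>x y. \<omega> (x + y) = \<omega> x + \<omega> y) \<and> (\<forall>c x. \<omega> (scaleC c x) = c * \<omega> x) \<and>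
     (\<forall>x. Im (\<omega> (adj x * x)) = 0 \<and> 0 \<le> Re (\<omega> (adj x * x))) \<and> \<omega> 1 = 1"

definition representation :: "'h hilb \<Rightarrow> ('a::cstar_algebra \<Rightarrow> 'h \<Rightarrow> 'h) \<Rightarrow> bool" where
  "representation H \<pi> \<longleftrightarrow>
     (\<forall>a. hbounded_op H (\<pi> a)) \<and>
     (\<forall>x\<in>hcarrier H.
        \<pi> 1 x = x \<and>
        (\<forall>a b. \<pi> (a + b) x = hadd H (\<pi> a x) (\<pi> b x)) \<and>
        (\<forall>c a. \<pi> (scaleC c a) x = hscale H c (\<pi> a x)) \<and>
        (\<forall>a b. \<pi> (a * b) x = \<pi> a (\<pi> b x)) \<and>
        (\<forall>a. \<forall>y\<in>hcarrier H. hinner H (\<pi> (adj a) x) y = hinner H x (\<pi> a y)))"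

definition cyclic_space :: "'h hilb \<Rightarrow> ('a::cstar_algebra \<Rightarrow> 'h \<Rightarrow> 'h) \<Rightarrow> 'h \<Rightarrow> 'h hilb" where
  "cyclic_space H \<pi> v = hrestrict H (closed_span H {\<pi> a v | a. True})"

definition multi_prod :: "('i \<Rightarrow> 'a::monoid_mult) \<Rightarrow> 'i list \<Rightarrow> 'a" where
  "multi_prod s \<alpha> = prod_list (map s \<alpha>)"

end

theory Submission
  imports Defs
begin

text \<open>
  Since \<open>T\<^sub>i (1 \<otimes> \<xi>)\<close> is supported on \<open>x\<^sub>1 = i\<close>, one finds \<open>T\<^sub>i\<^sup>* (1 \<otimes> \<xi>\<^sub>h) = p\<^sub>i\<^sup>1\<^sup>/\<^sup>2 (1 \<otimes> \<xi>\<^sub>k)\<close> with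
  \<open>k = g\<^sub>i\<^sup>-\<^sup>1 h\<close>. Hence \<open>\<pi>(s\<^sub>\<alpha> s\<^sub>\<gamma>\<^sup>*) \<Omega>\<^sub>0\<close> is a nonzero multiple of \<open>T\<^sub>\<alpha> (1 \<otimes> \<lambda>(g\<^sub>\<gamma>\<^sup>-\<^sup>1) \<xi>\<^sub>e)\<close>, so the isometries
  \<open>\<xi> \<mapsto> T\<^sub>\<alpha> (1 \<otimes> \<xi>)\<close> on \<open>\<H>\<^sub>-\<close> fiber the closed span of the vectors \<open>\<pi>(s\<^sub>\<alpha> s\<^sub>\<gamma>\<^sup>*) \<Omega>\<^sub>0\<close>. The words
  \<open>s\<^sub>\<alpha> s\<^sub>\<gamma>\<^sup>*\<close> span a dense subspace of the algebra, and states and representations are automatically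
  continuous because \<open>1 - b\<close> is a square for self-adjoint \<open>b\<close> of norm less than \<open>1\<close>; this gives both
  the vector state formula and that the span is the whole cyclic space.
\<close>

section \<open>Hilbert spaces with explicit carrier\<close>

text \<open>Nothing is known about \<open>\<pi>\<close> beyond the axioms of a representation and
  its values on the generators, and \<open>T_op\<close> is defined through an arbitrarily chosen
  representative of a class. Linearity, boundedness and adjoints of the T_i are therefore never
  derived from the formula for \<open>T_op\<close>; they are inherited from \<open>\<pi>\<close>.
  The formula itself is evaluated only at constant functions, where a representative composed with
  the shift is known almost everywhere because the shift preserves the measure. For other vectors
  only the support of its values is read off. The definition of a fibered space also demands that
  the cyclic space and H_- be complete. This is why completeness of \<open>ell2\<close> and of the
  vector-valued \<open>L2\<close> is established and passed on to closed subspaces.\<close>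

context complex_hilbert_space
begin

lemma inner_add_left:
  "\<lbrakk>x \<in> hcarrier H; y \<in> hcarrier H; z \<in> hcarrier H\<rbrakk> \<Longrightarrow>
    hinner H (hadd H x y) z = hinner H x z + hinner H y z"
  by (metis add_closed complex_cnj_add inner_add_right inner_commute)

lemma inner_scale_left:
  "\<lbrakk>x \<in> hcarrier H; y \<in> hcarrier H\<rbrakk> \<Longrightarrow> hinner H (hscale H c x) y = cnj c * hinner H x y"
  by (metis scale_closed complex_cnj_mult inner_scale_right inner_commute)

lemma scale_zero_eq: "x \<in> hcarrier H \<Longrightarrow> hscale H 0 x = hzero H"
  by (metis add_inverse add.right_inverse scale_add_left scale_one)

lemma inner_zero_right: "x \<in> hcarrier H \<Longrightarrow> hinner H x (hzero H) = 0"
  by (metis inner_scale_right mult_zero_left scale_zero_eq zero_closed)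

lemma inner_zero_left: "x \<in> hcarrier H \<Longrightarrow> hinner H (hzero H) x = 0"
  by (metis inner_scale_left mult_zero_left scale_zero_eq zero_closed complex_cnj_zero)

lemma hnorm_nonneg: "x \<in> hcarrier H \<Longrightarrow> 0 \<le> hnorm H x"
  by (simp add: hnorm_def inner_nonneg)

lemma hnorm_sq: "x \<in> hcarrier H \<Longrightarrow> (hnorm H x)\<^sup>2 = Re (hinner H x x)"
  by (simp add: hnorm_def inner_nonneg)

lemma inner_self: "x \<in> hcarrier H \<Longrightarrow> hinner H x x = complex_of_real ((hnorm H x)\<^sup>2)"
  using inner_commute[of x x] by (simp add: hnorm_sq complex_eq_iff)

lemma hnorm_zero: "hnorm H (hzero H) = 0"
  by (simp add: hnorm_def inner_zero_right zero_closed)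

lemma hnorm_eq_0: "x \<in> hcarrier H \<Longrightarrow> hnorm H x = 0 \<longleftrightarrow> x = hzero H"
  using inner_self[of x] inner_definite[of x] hnorm_zero by auto

lemma hnorm_scale: "x \<in> hcarrier H \<Longrightarrow> hnorm H (hscale H c x) = cmod c * hnorm H x"
proof -
  assume x: "x \<in> hcarrier H"
  have "(hnorm H (hscale H c x))\<^sup>2 = Re ((cnj c * c) * hinner H x x)"
    using x by (simp add: hnorm_sq scale_closed inner_scale_left inner_scale_right del: times_complex.sel)
      (simp add: mult_ac del: times_complex.sel)
  also have "\<dots> = (cmod c * hnorm H x)\<^sup>2"
    using x by (simp add: inner_self power_mult_distrib cmod_power2)
      (simp add: power2_eq_square algebra_simps)
  finally show ?thesis
    using x by (simp add: hnorm_nonneg scale_closed power2_eq_iff_nonneg)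
qed

lemma hnorm_add_sq:
  assumes "x \<in> hcarrier H" "y \<in> hcarrier H"
  shows "(hnorm H (hadd H x y))\<^sup>2 = (hnorm H x)\<^sup>2 + 2 * Re (hinner H x y) + (hnorm H y)\<^sup>2"
  using assms inner_commute[of y x]
  by (simp add: hnorm_sq add_closed inner_add_left inner_add_right)

lemma Cauchy_Schwarz:
  assumes x: "x \<in> hcarrier H" and y: "y \<in> hcarrier H"
  shows "cmod (hinner H x y) \<le> hnorm H x * hnorm H y"
proof (cases "hnorm H y = 0")
  case True
  then show ?thesis using x y by (simp add: hnorm_eq_0 inner_zero_right hnorm_zero)
next
  case False
  then have pos: "hnorm H y > 0" using hnorm_nonneg[OF y] by simp
  define z where "z = hinner H x y"
  \<comment> \<open>With this \<open>c\<close> the vector x + c y is orthogonal to y: the inner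
    product of y with x is \<open>cnj z\<close>, and the second slot is the linear one.\<close>
  define c where "c = - (cnj z / complex_of_real ((hnorm H y)\<^sup>2))"
  have cm: "(cmod c * hnorm H y)\<^sup>2 = (cmod z)\<^sup>2 / (hnorm H y)\<^sup>2"
    using pos by (simp add: c_def norm_divide norm_power power_mult_distrib field_simps)
  have "c * z = - complex_of_real ((cmod z)\<^sup>2 / (hnorm H y)\<^sup>2)"
    unfolding c_def using complex_norm_square[of z] by (simp add: mult.commute)
  then have re: "Re (c * z) = - ((cmod z)\<^sup>2 / (hnorm H y)\<^sup>2)"
    by (simp only: Re_complex_of_real uminus_complex.sel)
  have "0 \<le> (hnorm H (hadd H x (hscale H c y)))\<^sup>2" by simp
  also have "\<dots> = (hnorm H x)\<^sup>2 + 2 * Re (c * z) + (cmod c * hnorm H y)\<^sup>2"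
    using x y by (simp only: hnorm_add_sq scale_closed inner_scale_right hnorm_scale z_def)
  also have "\<dots> = (hnorm H x)\<^sup>2 - (cmod z)\<^sup>2 / (hnorm H y)\<^sup>2"
    by (simp only: re cm)
  finally have "(cmod z)\<^sup>2 \<le> (hnorm H x * hnorm H y)\<^sup>2"
    using pos by (simp add: field_simps)
  then show ?thesis
    unfolding z_def using x y by (meson hnorm_nonneg mult_nonneg_nonneg power2_le_imp_le)
qed

lemma hnorm_triangle:
  assumes x: "x \<in> hcarrier H" and y: "y \<in> hcarrier H"
  shows "hnorm H (hadd H x y) \<le> hnorm H x + hnorm H y"
proof (rule power2_le_imp_le)
  show "(hnorm H (hadd H x y))\<^sup>2 \<le> (hnorm H x + hnorm H y)\<^sup>2"
    using Cauchy_Schwarz[OF x y] complex_Re_le_cmod[of "hinner H x y"]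
    by (simp add: hnorm_add_sq x y power2_sum)
qed (simp add: x y hnorm_nonneg)

text \<open>A bound without cross term, so that integrability of two squared norms gives that of the
  squared norm of a sum.\<close>

lemma hnorm_add_sq_le:
  assumes x: "x \<in> hcarrier H" and y: "y \<in> hcarrier H"
  shows "(hnorm H (hadd H x y))\<^sup>2 \<le> 2 * (hnorm H x)\<^sup>2 + 2 * (hnorm H y)\<^sup>2"
proof -
  have "(hnorm H (hadd H x y))\<^sup>2 \<le> (hnorm H x + hnorm H y)\<^sup>2"
    by (intro power_mono hnorm_triangle hnorm_nonneg add_closed x y)
  also have "\<dots> \<le> 2 * (hnorm H x)\<^sup>2 + 2 * (hnorm H y)\<^sup>2"
    using sum_squares_ge_zero[of "hnorm H x - hnorm H y" 0]
    by (simp add: power2_eq_square algebra_simps)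
  finally show ?thesis .
qed

text \<open>The analogous majorant for inner products: it is integrable as soon as both squared
  norms are.\<close>

lemma cmod_inner_le:
  assumes x: "x \<in> hcarrier H" and y: "y \<in> hcarrier H"
  shows "cmod (hinner H x y) \<le> (hnorm H x)\<^sup>2 + (hnorm H y)\<^sup>2"
proof -
  have "hnorm H x * hnorm H y \<le> (hnorm H x)\<^sup>2 + (hnorm H y)\<^sup>2"
    using sum_squares_bound[of "hnorm H x" "hnorm H y"] mult_nonneg_nonneg[OF hnorm_nonneg[OF x] hnorm_nonneg[OF y]]
    by linarith
  with Cauchy_Schwarz[OF x y] show ?thesis by linarith
qed

lemma sub_closed: "\<lbrakk>x \<in> hcarrier H; y \<in> hcarrier H\<rbrakk> \<Longrightarrow> hadd H x (hscale H (-1) y) \<in> hcarrier H"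
  by (simp add: add_closed scale_closed)

lemma neg_add: "y \<in> hcarrier H \<Longrightarrow> hadd H (hscale H (-1) y) y = hzero H"
  by (metis add_commute add_inverse scale_closed)

lemma sub_add_cancel:
  "\<lbrakk>x \<in> hcarrier H; y \<in> hcarrier H\<rbrakk> \<Longrightarrow> hadd H (hadd H x (hscale H (-1) y)) y = x"
  by (simp add: add_assoc scale_closed neg_add add_zero)

lemma sub_sub:
  assumes "x \<in> hcarrier H" "y \<in> hcarrier H" "z \<in> hcarrier H"
  shows "hadd H (hadd H x (hscale H (-1) y)) (hadd H y (hscale H (-1) z)) = hadd H x (hscale H (-1) z)"
  using assms by (simp only: sub_add_cancel scale_closed sub_closed flip: add_assoc)

lemma add_left_commute:
  "\<lbrakk>x \<in> hcarrier H; y \<in> hcarrier H; z \<in> hcarrier H\<rbrakk> \<Longrightarrow> hadd H x (hadd H y z) = hadd H y (hadd H x z)"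
  by (metis add_assoc add_commute)

section \<open>Distances and limits\<close>

lemma hdist_nonneg: "\<lbrakk>x \<in> hcarrier H; y \<in> hcarrier H\<rbrakk> \<Longrightarrow> 0 \<le> hdist H x y"
  by (simp add: hdist_def hnorm_nonneg sub_closed)

lemma hdist_self: "x \<in> hcarrier H \<Longrightarrow> hdist H x x = 0"
  by (simp add: hdist_def add_inverse hnorm_zero)

lemma hdist_commute:
  assumes x: "x \<in> hcarrier H" and y: "y \<in> hcarrier H"
  shows "hdist H x y = hdist H y x"
proof -
  have "hscale H (-1) (hadd H x (hscale H (-1) y)) = hadd H y (hscale H (-1) x)"
    using x y by (simp add: scale_add_right scale_closed scale_scale scale_one add_commute[of y])
  then show ?thesis
    unfolding hdist_def using hnorm_scale[of "hadd H x (hscale H (-1) y)" "-1"] x y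
    by (simp add: sub_closed)
qed

lemma hdist_triangle:
  "\<lbrakk>x \<in> hcarrier H; y \<in> hcarrier H; z \<in> hcarrier H\<rbrakk> \<Longrightarrow> hdist H x z \<le> hdist H x y + hdist H y z"
  unfolding hdist_def using hnorm_triangle[of "hadd H x (hscale H (-1) y)" "hadd H y (hscale H (-1) z)"]
  by (simp only: sub_closed sub_sub)

lemma hdist_add:
  assumes "x \<in> hcarrier H" "y \<in> hcarrier H" "x' \<in> hcarrier H" "y' \<in> hcarrier H"
  shows "hdist H (hadd H x y) (hadd H x' y') \<le> hdist H x x' + hdist H y y'"
proof -
  have "hadd H (hadd H x y) (hscale H (-1) (hadd H x' y')) =
      hadd H (hadd H x (hscale H (-1) x')) (hadd H y (hscale H (-1) y'))"
    using assms by (simp only: scale_add_right add_assoc add_closed scale_closed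
        add_left_commute[of y "hscale H (- 1) x'" "hscale H (- 1) y'"])
  then show ?thesis
    unfolding hdist_def using assms by (simp add: hnorm_triangle sub_closed)
qed

lemma hdist_scale:
  assumes "x \<in> hcarrier H" "x' \<in> hcarrier H"
  shows "hdist H (hscale H c x) (hscale H c x') = cmod c * hdist H x x'"
proof -
  have "hadd H (hscale H c x) (hscale H (-1) (hscale H c x')) = hscale H c (hadd H x (hscale H (-1) x'))"
    using assms by (simp add: scale_add_right scale_closed scale_scale)
  then show ?thesis using assms by (simp add: hdist_def hnorm_scale sub_closed)
qed

lemma inner_tendsto:
  assumes "\<And>n. X n \<in> hcarrier H" "l \<in> hcarrier H" "(\<lambda>n. hdist H (X n) l) \<longlonglongrightarrow> 0"
    and k: "k \<in> hcarrier H"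
  shows "(\<lambda>n. hinner H k (X n)) \<longlonglongrightarrow> hinner H k l"
proof (rule iffD2[OF Lim_null])
  have "cmod (hinner H k (X n) - hinner H k l) \<le> hnorm H k * hdist H (X n) l" for n
  proof -
    have "hinner H k (X n) - hinner H k l = hinner H k (hadd H (X n) (hscale H (-1) l))"
      using assms by (simp add: inner_add_right inner_scale_right scale_closed)
    then show ?thesis using Cauchy_Schwarz[OF k sub_closed, of "X n" l] assms
      by (simp add: hdist_def)
  qed
  then show "(\<lambda>n. hinner H k (X n) - hinner H k l) \<longlonglongrightarrow> 0"
    by (intro Lim_null_comparison[OF _ tendsto_mult_right_zero[OF assms(3), of "hnorm H k"]]) auto
qed

lemma hdist_tendsto:
  assumes "\<And>n. X n \<in> hcarrier H" "l \<in> hcarrier H" "(\<lambda>n. hdist H (X n) l) \<longlonglongrightarrow> 0"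
    and k: "k \<in> hcarrier H"
  shows "(\<lambda>n. hdist H k (X n)) \<longlonglongrightarrow> hdist H k l"
proof (rule iffD2[OF Lim_null])
  have "\<bar>hdist H k (X n) - hdist H k l\<bar> \<le> hdist H (X n) l" for n
    using hdist_triangle[of k l "X n"] hdist_triangle[of k "X n" l] hdist_commute[of "X n" l] assms
    by simp
  then show "(\<lambda>n. hdist H k (X n) - hdist H k l) \<longlonglongrightarrow> 0"
    by (intro Lim_null_comparison[OF _ assms(3)]) auto
qed

subsection \<open>Closed subspaces\<close>

lemma hspan_subspace:
  assumes "S \<subseteq> hcarrier H"
  shows "hsubspace H (hspan H S)"
proof -
  have "hsubspace H (hcarrier H)"
    by (simp add: hsubspace_def zero_closed add_closed scale_closed)
  then have "hspan H S \<subseteq> hcarrier H"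
    using assms by (auto simp: hspan_def)
  then show ?thesis
    unfolding hsubspace_def by (auto simp: hspan_def hsubspace_def)
qed

lemma hspan_superset: "S \<subseteq> hspan H S"
  by (auto simp: hspan_def)

lemma hspan_minimal: "\<lbrakk>hsubspace H V; S \<subseteq> V\<rbrakk> \<Longrightarrow> hspan H S \<subseteq> V"
  by (auto simp: hspan_def)

lemma hclosure_superset: "S \<subseteq> hcarrier H \<Longrightarrow> S \<subseteq> hclosure H S"
  by (force simp: hclosure_def hdist_self)

lemma hclosure_mono: "S \<subseteq> T \<Longrightarrow> hclosure H S \<subseteq> hclosure H T"
  by (fastforce simp: hclosure_def)

lemma hclosure_hclosure:
  assumes S: "S \<subseteq> hcarrier H"
  shows "hclosure H (hclosure H S) \<subseteq> hclosure H S"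
proof
  fix x assume x: "x \<in> hclosure H (hclosure H S)"
  show "x \<in> hclosure H S"
    unfolding hclosure_def
  proof (intro CollectI conjI allI impI)
    show xC: "x \<in> hcarrier H" using x by (simp add: hclosure_def)
    fix e :: real assume e: "e > 0"
    then have e2: "e / 2 > 0" by simp
    then obtain y where y: "y \<in> hclosure H S" "hdist H x y < e / 2"
      using x unfolding hclosure_def[of H "hclosure H S"] by blast
    then obtain z where z: "z \<in> S" "hdist H y z < e / 2"
      using e2 unfolding hclosure_def by blast
    have "hdist H x z \<le> hdist H x y + hdist H y z"
      using xC y z S by (intro hdist_triangle) (auto simp: hclosure_def)
    then show "\<exists>z\<in>S. hdist H x z < e" using y z by (intro bexI[of _ z]) auto
  qed
qed

lemma hclosure_subspace:
  assumes V: "hsubspace H V"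
  shows "hsubspace H (hclosure H V)"
  unfolding hsubspace_def
proof (intro conjI ballI allI)
  have VC: "V \<subseteq> hcarrier H" using V by (simp add: hsubspace_def)
  show "hclosure H V \<subseteq> hcarrier H" by (auto simp: hclosure_def)
  show "hzero H \<in> hclosure H V"
    using V hclosure_superset[OF VC] by (auto simp: hsubspace_def)
  fix x assume x: "x \<in> hclosure H V"
  then have xC: "x \<in> hcarrier H" by (simp add: hclosure_def)
  show "hadd H x y \<in> hclosure H V" if y: "y \<in> hclosure H V" for y
    unfolding hclosure_def
  proof (intro CollectI conjI allI impI)
    have yC: "y \<in> hcarrier H" using y by (simp add: hclosure_def)
    then show "hadd H x y \<in> hcarrier H" using xC by (simp add: add_closed)
    fix e :: real assume e: "e > 0"
    then have e2: "e / 2 > 0" by simp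
    obtain x' where x': "x' \<in> V" "hdist H x x' < e / 2"
      using x e2 unfolding hclosure_def by blast
    obtain y' where y': "y' \<in> V" "hdist H y y' < e / 2"
      using y e2 unfolding hclosure_def by blast
    have "hdist H (hadd H x y) (hadd H x' y') < e"
      using hdist_add[of x y x' y'] xC yC VC x' y' by (simp add: subset_iff)
    then show "\<exists>z\<in>V. hdist H (hadd H x y) z < e"
      using V x' y' unfolding hsubspace_def by blast
  qed
  show "hscale H c x \<in> hclosure H V" for c
    unfolding hclosure_def
  proof (intro CollectI conjI allI impI)
    show "hscale H c x \<in> hcarrier H" using xC by (simp add: scale_closed)
    fix e :: real assume e: "e > 0"
    \<comment> \<open>The summand 1 keeps the divisor positive when c = 0.\<close>
    then have "e / (cmod c + 1) > 0" by (simp add: add_nonneg_pos)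
    then obtain x' where *: "x' \<in> V" "hdist H x x' < e / (cmod c + 1)"
      using x unfolding hclosure_def by blast
    then have "hdist H x x' * (cmod c + 1) < e"
      by (simp add: pos_less_divide_eq add_nonneg_pos)
    moreover have "cmod c * hdist H x x' \<le> hdist H x x' * (cmod c + 1)"
      using hdist_nonneg[OF xC, of x'] * VC by (auto simp: algebra_simps)
    ultimately have "hdist H (hscale H c x) (hscale H c x') < e"
      using hdist_scale[OF xC, of x' c] * VC by auto
    then show "\<exists>z\<in>V. hdist H (hscale H c x) z < e"
      using V * unfolding hsubspace_def by blast
  qed
qed

lemma closed_span_subspace: "S \<subseteq> hcarrier H \<Longrightarrow> hsubspace H (closed_span H S)"
  by (simp add: closed_span_def hclosure_subspace hspan_subspace)

lemma closed_span_closed: "S \<subseteq> hcarrier H \<Longrightarrow> hclosure H (closed_span H S) \<subseteq> closed_span H S"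
  using hspan_subspace[of S] by (simp add: closed_span_def hclosure_hclosure hsubspace_def)

lemma closed_span_superset: "S \<subseteq> hcarrier H \<Longrightarrow> S \<subseteq> closed_span H S"
  using hspan_subspace[of S] hspan_superset[of S] hclosure_superset[of "hspan H S"]
  by (auto simp: closed_span_def hsubspace_def)

lemma closed_span_minimal:
  "\<lbrakk>hsubspace H V; hclosure H V \<subseteq> V; S \<subseteq> V\<rbrakk> \<Longrightarrow> closed_span H S \<subseteq> V"
  unfolding closed_span_def using hspan_minimal[of V S] hclosure_mono[of "hspan H S" V] by simp

text \<open>The restricted record keeps all operations, hence all distances. A Cauchy sequence has
  its limit in \<open>H\<close>, and closedness of \<open>V\<close> keeps that limit inside.\<close>

lemma hrestrict_hilbert:
  assumes V: "hsubspace H V" and cl: "hclosure H V \<subseteq> V"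
  shows "complex_hilbert_space (hrestrict H V)"
proof -
  have VC: "V \<subseteq> hcarrier H" using V by (simp add: hsubspace_def)
  have dist: "hdist (hrestrict H V) = hdist H"
    by (simp add: fun_eq_iff hdist_def hnorm_def hrestrict_def)
  show ?thesis
  proof
    fix X :: "nat \<Rightarrow> 'h" assume 18: "\<And>n. X n \<in> hcarrier (hrestrict H V)"
      "\<forall>e>0. \<exists>N. \<forall>m\<ge>N. \<forall>n\<ge>N. hdist (hrestrict H V) (X m) (X n) < e"
    then have XV: "X n \<in> V" for n by (simp add: hrestrict_def)
    have "\<exists>l\<in>hcarrier H. (\<lambda>n. hdist H (X n) l) \<longlonglongrightarrow> 0"
      by (rule complete) (use 18(2) XV VC in \<open>auto simp: dist\<close>)
    then obtain l where l: "l \<in> hcarrier H" "(\<lambda>n. hdist H (X n) l) \<longlonglongrightarrow> 0" by blast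
    have "l \<in> hclosure H V"
      unfolding hclosure_def
    proof (intro CollectI conjI allI impI l)
      fix e :: real assume "e > 0"
      with l(2) have "\<forall>\<^sub>F n in sequentially. hdist H (X n) l < e"
        by (simp add: order_tendstoD)
      then obtain n where "hdist H (X n) l < e"
        by (meson eventually_sequentially order_refl)
      then show "\<exists>y\<in>V. hdist H l y < e"
        using XV[of n] hdist_commute[of l "X n"] l VC by (intro bexI[of _ "X n"]) auto
    qed
    then show "\<exists>l\<in>hcarrier (hrestrict H V). (\<lambda>n. hdist (hrestrict H V) (X n) l) \<longlonglongrightarrow> 0"
      unfolding dist using l cl by (auto simp: hrestrict_def)
  qed (use V VC in \<open>simp_all add: hrestrict_def hsubspace_def subset_iff add_assoc add_zero add_inverse
       scale_add_right scale_add_left scale_scale scale_one inner_add_right inner_scale_right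
       inner_nonneg inner_definite\<close>, metis add_commute, metis inner_commute)
qed

text \<open>\<open>fibered_over\<close> forms the closed span inside the cyclic space, whereas
  generators are handled in the ambient space. Subspaces of \<open>H\<close> that contain
  \<open>S\<close> may be cut down to \<open>V\<close>, so both spans agree, and the relative
  closure adds only an intersection with \<open>V\<close>, which already contains the closed
  span.\<close>

lemma closed_span_hrestrict:
  assumes V: "hsubspace H V" and cl: "hclosure H V \<subseteq> V" and S: "S \<subseteq> V"
  shows "closed_span (hrestrict H V) S = closed_span H S"
proof -
  have sub: "hsubspace (hrestrict H V) W \<longleftrightarrow> hsubspace H W \<and> W \<subseteq> V" for W
    using V by (auto simp: hsubspace_def hrestrict_def)
  have "hspan (hrestrict H V) S = hspan H S"
  proof
    show "hspan (hrestrict H V) S \<subseteq> hspan H S"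
    proof
      fix x assume x: "x \<in> hspan (hrestrict H V) S"
      show "x \<in> hspan H S"
        unfolding hspan_def
      proof (intro InterI, clarify)
        fix W assume W: "hsubspace H W" "S \<subseteq> W"
        have "hsubspace H (W \<inter> V)" using W V by (auto simp: hsubspace_def)
        then have "x \<in> W \<inter> V" using x W S by (auto simp: hspan_def sub)
        then show "x \<in> W" by simp
      qed
    qed
  qed (auto simp: hspan_def sub)
  moreover have "hclosure (hrestrict H V) W = V \<inter> hclosure H W" for W
    using V by (auto simp: hclosure_def hrestrict_def hdist_def hnorm_def hsubspace_def)
  moreover have "closed_span H S \<subseteq> V" by (rule closed_span_minimal[OF V cl S])
  ultimately show ?thesis by (auto simp: closed_span_def)
qed

end

text \<open>Together with \<open>closed_span_minimal\<close> this carries membership in a closed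
  subspace over to closed spans: if \<open>f\<close> sends generators into \<open>V\<close>, it
  sends their whole closed span there.\<close>

lemma hlinear_isometry_preimage:
  assumes H: "complex_hilbert_space H" and K: "complex_hilbert_space K"
    and f: "hisometry K H f"
    and V: "hsubspace H V" and cl: "hclosure H V \<subseteq> V"
  shows "hsubspace K {k \<in> hcarrier K. f k \<in> V}"
    and "hclosure K {k \<in> hcarrier K. f k \<in> V} \<subseteq> {k \<in> hcarrier K. f k \<in> V}"
proof -
  interpret H: complex_hilbert_space H by fact
  interpret K: complex_hilbert_space K by fact
  have lin: "f x \<in> hcarrier H" "f (hscale K c x) = hscale H c (f x)"
    "y \<in> hcarrier K \<Longrightarrow> f (hadd K x y) = hadd H (f x) (f y)"
    "hnorm H (f x) = hnorm K x" if "x \<in> hcarrier K" for x y c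
    using f that by (auto simp: hisometry_def hlinear_def)
  have f0: "f (hzero K) = hzero H"
    using lin[of "hzero K"] K.scale_zero_eq H.scale_zero_eq K.zero_closed by metis
  have dist: "hdist H (f x) (f y) = hdist K x y" if "x \<in> hcarrier K" "y \<in> hcarrier K" for x y
  proof -
    have "f (hadd K x (hscale K (-1) y)) = hadd H (f x) (hscale H (-1) (f y))"
      using that by (simp add: lin K.scale_closed)
    then show ?thesis using that lin(4)[OF K.sub_closed, of x y] by (simp add: hdist_def)
  qed
  show "hsubspace K {k \<in> hcarrier K. f k \<in> V}"
    using V by (auto simp: hsubspace_def lin f0 K.zero_closed K.add_closed K.scale_closed)
  show "hclosure K {k \<in> hcarrier K. f k \<in> V} \<subseteq> {k \<in> hcarrier K. f k \<in> V}"
  proof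
    fix k assume k: "k \<in> hclosure K {k \<in> hcarrier K. f k \<in> V}"
    then have kC: "k \<in> hcarrier K" by (simp add: hclosure_def)
    have "f k \<in> hclosure H V"
      using k kC unfolding hclosure_def by (force simp: lin dist)
    then show "k \<in> {k \<in> hcarrier K. f k \<in> V}" using kC cl by auto
  qed
qed

section \<open>The space \<open>\<ell>\<^sup>2\<close>\<close>

lemma ell2_sel [simp]:
  "hadd (ell2 I) = (\<lambda>f f' g. f g + f' g)" "hzero (ell2 I) = (\<lambda>g. 0)"
  "hscale (ell2 I) = (\<lambda>c f g. c * f g)"
  by (simp_all add: ell2_def)

lemma ell2_carrier_iff:
  "f \<in> hcarrier (ell2 I) \<longleftrightarrow> (\<forall>g. g \<notin> I \<longrightarrow> f g = 0) \<and> (\<lambda>g. (cmod (f g))\<^sup>2) summable_on I"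
  by (simp add: ell2_def)

lemma ell2_inner: "hinner (ell2 I) f f' = (\<Sum>\<^sub>\<infinity>g\<in>I. cnj (f g) * f' g)"
  by (simp add: ell2_def)

lemma ell2_inner_summable:
  assumes "f \<in> hcarrier (ell2 I)" "f' \<in> hcarrier (ell2 I)"
  shows "(\<lambda>g. cnj (f g) * f' g) summable_on I"
proof (rule abs_summable_summable)
  have "(\<lambda>g. (cmod (f g))\<^sup>2 + (cmod (f' g))\<^sup>2) summable_on I"
    using assms by (intro summable_on_add) (simp_all add: ell2_carrier_iff)
  then show "(\<lambda>g. norm (cnj (f g) * f' g)) summable_on I"
  proof (rule Infinite_Sum.abs_summable_on_comparison_test')
    show "norm (cnj (f g) * f' g) \<le> (cmod (f g))\<^sup>2 + (cmod (f' g))\<^sup>2" for g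
      using sum_squares_bound[of "cmod (f g)" "cmod (f' g)"]
        mult_nonneg_nonneg[OF norm_ge_zero norm_ge_zero, of "f g" "f' g"]
      unfolding norm_mult complex_mod_cnj by linarith
  qed
qed

lemma ell2_inner_self:
  assumes "f \<in> hcarrier (ell2 I)"
  shows "hinner (ell2 I) f f = complex_of_real (\<Sum>\<^sub>\<infinity>g\<in>I. (cmod (f g))\<^sup>2)"
proof -
  have "((\<lambda>g. complex_of_real ((cmod (f g))\<^sup>2)) has_sum complex_of_real (\<Sum>\<^sub>\<infinity>g\<in>I. (cmod (f g))\<^sup>2)) I"
    using assms by (intro has_sum_of_real has_sum_infsum) (simp add: ell2_carrier_iff)
  moreover have "cnj (f g) * f g = complex_of_real ((cmod (f g))\<^sup>2)" for g
    by (metis complex_norm_square mult.commute)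
  ultimately show ?thesis
    by (simp only: ell2_inner infsumI)
qed

lemma ell2_add_closed:
  assumes "f \<in> hcarrier (ell2 I)" "f' \<in> hcarrier (ell2 I)"
  shows "(\<lambda>g. f g + f' g) \<in> hcarrier (ell2 I)"
proof -
  have "(\<lambda>g. (cmod (f g + f' g))\<^sup>2) summable_on I"
  proof (rule summable_on_comparison_test)
    show "(\<lambda>g. 2 * (cmod (f g))\<^sup>2 + 2 * (cmod (f' g))\<^sup>2) summable_on I"
      using assms by (intro summable_on_add summable_on_cmult_right) (simp_all add: ell2_carrier_iff)
    show "(cmod (f g + f' g))\<^sup>2 \<le> 2 * (cmod (f g))\<^sup>2 + 2 * (cmod (f' g))\<^sup>2" for g
    proof -
      have "(cmod (f g + f' g))\<^sup>2 \<le> (cmod (f g) + cmod (f' g))\<^sup>2"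
        by (intro power_mono norm_triangle_ineq norm_ge_zero)
      then show ?thesis
        using sum_squares_bound[of "cmod (f g)" "cmod (f' g)"] by (simp add: power2_sum)
    qed
  qed simp
  then show ?thesis using assms by (simp add: ell2_carrier_iff)
qed

lemma ell2_scale_closed:
  "f \<in> hcarrier (ell2 I) \<Longrightarrow> (\<lambda>g. c * f g) \<in> hcarrier (ell2 I)"
  by (auto simp: ell2_carrier_iff norm_mult power_mult_distrib intro: summable_on_cmult_right)

lemma ell2_diff_closed:
  "\<lbrakk>f \<in> hcarrier (ell2 I); f' \<in> hcarrier (ell2 I)\<rbrakk> \<Longrightarrow> (\<lambda>g. f g - f' g) \<in> hcarrier (ell2 I)"
  using ell2_add_closed[OF _ ell2_scale_closed[of _ _ "-1"]] by fastforce

lemma ell2_hdist: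
  assumes "f \<in> hcarrier (ell2 I)" "f' \<in> hcarrier (ell2 I)"
  shows "hdist (ell2 I) f f' = sqrt (\<Sum>\<^sub>\<infinity>g\<in>I. (cmod (f g - f' g))\<^sup>2)"
  using ell2_inner_self[OF ell2_diff_closed[OF assms]]
  by (simp add: hdist_def hnorm_def)

lemma ell2_finite_sum_le:
  assumes "f \<in> hcarrier (ell2 I)" "f' \<in> hcarrier (ell2 I)" "finite F" "F \<subseteq> I"
  shows "(\<Sum>g\<in>F. (cmod (f g - f' g))\<^sup>2) \<le> (hdist (ell2 I) f f')\<^sup>2"
proof -
  have "(\<Sum>g\<in>F. (cmod (f g - f' g))\<^sup>2) \<le> (\<Sum>\<^sub>\<infinity>g\<in>I. (cmod (f g - f' g))\<^sup>2)"
    using assms ell2_diff_closed[OF assms(1,2)]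
    by (intro finite_sum_le_infsum) (auto simp: ell2_carrier_iff)
  then show ?thesis using assms by (simp add: ell2_hdist infsum_nonneg)
qed

text \<open>Coordinates converge because their differences are dominated by the distance. The limit
  is then passed through finite sums only, and bounds uniform in the finite set recover the
  norm.\<close>

lemma ell2_complete:
  fixes X :: "nat \<Rightarrow> 'g \<Rightarrow> complex"
  assumes X: "\<And>n. X n \<in> hcarrier (ell2 I)"
    and Cauchy: "\<forall>e>0. \<exists>N. \<forall>m\<ge>N. \<forall>n\<ge>N. hdist (ell2 I) (X m) (X n) < e"
  shows "\<exists>l\<in>hcarrier (ell2 I). (\<lambda>n. hdist (ell2 I) (X n) l) \<longlonglongrightarrow> 0"
proof -
  have coord: "cmod (X m g - X n g) \<le> hdist (ell2 I) (X m) (X n)" for m n g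
  proof (cases "g \<in> I")
    case True
    have "(cmod (X m g - X n g))\<^sup>2 \<le> (hdist (ell2 I) (X m) (X n))\<^sup>2"
      using ell2_finite_sum_le[OF X X, of "{g}"] True by simp
    then show ?thesis
      by (rule power2_le_imp_le) (simp add: ell2_hdist X infsum_nonneg)
  next
    case False
    then have "X n g = 0" for n using X[of n] by (simp add: ell2_carrier_iff)
    then show ?thesis by (simp add: ell2_hdist X infsum_nonneg)
  qed
  have "Cauchy (\<lambda>n. X n g)" for g
  proof (rule metric_CauchyI)
    fix e :: real assume "e > 0"
    then obtain N where "\<And>m n. m \<ge> N \<Longrightarrow> n \<ge> N \<Longrightarrow> hdist (ell2 I) (X m) (X n) < e"
      using Cauchy by blast
    then show "\<exists>N. \<forall>m\<ge>N. \<forall>n\<ge>N. dist (X m g) (X n g) < e"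
      using le_less_trans[OF coord] unfolding dist_norm by (intro exI[of _ N]) auto
  qed
  then have "\<exists>l. \<forall>g. (\<lambda>n. X n g) \<longlonglongrightarrow> l g"
    by (intro choice) (simp add: Cauchy_convergent_iff convergent_def)
  then obtain l where l: "\<And>g. (\<lambda>n. X n g) \<longlonglongrightarrow> l g" by blast
  have fin: "\<exists>N. \<forall>n\<ge>N. \<forall>F. finite F \<and> F \<subseteq> I \<longrightarrow> (\<Sum>g\<in>F. (cmod (X n g - l g))\<^sup>2) \<le> e\<^sup>2"
    if "e > 0" for e
  proof -
    obtain N where N: "\<And>m n. m \<ge> N \<Longrightarrow> n \<ge> N \<Longrightarrow> hdist (ell2 I) (X m) (X n) < e"
      using Cauchy \<open>e > 0\<close> by blast
    have "(\<Sum>g\<in>F. (cmod (X n g - l g))\<^sup>2) \<le> e\<^sup>2" if "n \<ge> N" "finite F" "F \<subseteq> I" for n F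
    proof (rule LIMSEQ_le_const2)
      show "(\<lambda>m. \<Sum>g\<in>F. (cmod (X n g - X m g))\<^sup>2) \<longlonglongrightarrow> (\<Sum>g\<in>F. (cmod (X n g - l g))\<^sup>2)"
        by (intro tendsto_intros l)
      have "(\<Sum>g\<in>F. (cmod (X n g - X m g))\<^sup>2) \<le> e\<^sup>2" if "m \<ge> N" for m
      proof -
        have "0 \<le> hdist (ell2 I) (X n) (X m)" by (simp add: ell2_hdist X infsum_nonneg)
        then have "(hdist (ell2 I) (X n) (X m))\<^sup>2 \<le> e\<^sup>2"
          using N[of n m] that \<open>n \<ge> N\<close> by (intro power_mono) auto
        then show ?thesis
          using ell2_finite_sum_le[OF X X \<open>finite F\<close> \<open>F \<subseteq> I\<close>, of n m] by linarith
      qed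
      then show "\<exists>M. \<forall>m\<ge>M. (\<Sum>g\<in>F. (cmod (X n g - X m g))\<^sup>2) \<le> e\<^sup>2" by blast
    qed
    then show ?thesis by blast
  qed
  have l0: "l g = 0" if "g \<notin> I" for g
    using l[of g] X that by (simp add: ell2_carrier_iff LIMSEQ_const_iff)
  obtain N where N: "\<And>n F. n \<ge> N \<Longrightarrow> finite F \<Longrightarrow> F \<subseteq> I \<Longrightarrow> (\<Sum>g\<in>F. (cmod (X n g - l g))\<^sup>2) \<le> 1\<^sup>2"
    using fin[of 1] by force
  have diff: "(\<lambda>g. X N g - l g) \<in> hcarrier (ell2 I)"
    unfolding ell2_carrier_iff
  proof (intro conjI allI impI)
    show "(\<lambda>g. (cmod (X N g - l g))\<^sup>2) summable_on I"
      by (rule nonneg_bdd_above_summable_on) (use N[of N] in \<open>auto simp: bdd_above_def\<close>)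
  qed (use l0 X in \<open>auto simp: ell2_carrier_iff\<close>)
  \<comment> \<open>\<open>l\<close> is the difference of \<open>X N\<close> and
    \<open>X N - l\<close>, both of which are square summable.\<close>
  have lC: "l \<in> hcarrier (ell2 I)"
    using ell2_diff_closed[OF X[of N] diff] by simp
  have "(\<lambda>n. hdist (ell2 I) (X n) l) \<longlonglongrightarrow> 0"
  proof (rule LIMSEQ_I)
    fix e :: real assume "e > 0"
    \<comment> \<open>The finite sums yield a weak inequality, so half of \<open>e\<close> is used
      to end with a strict one.\<close>
    then obtain N where N: "\<And>n F. n \<ge> N \<Longrightarrow> finite F \<Longrightarrow> F \<subseteq> I \<Longrightarrow>
        (\<Sum>g\<in>F. (cmod (X n g - l g))\<^sup>2) \<le> (e / 2)\<^sup>2"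
      using fin[of "e / 2"] by force
    have "hdist (ell2 I) (X n) l < e" if "n \<ge> N" for n
    proof -
      have "(\<Sum>\<^sub>\<infinity>g\<in>I. (cmod (X n g - l g))\<^sup>2) \<le> (e / 2)\<^sup>2"
        using ell2_diff_closed[OF X[of n] lC] N[OF that]
        by (intro infsum_le_finite_sums) (auto simp: ell2_carrier_iff)
      then have "hdist (ell2 I) (X n) l \<le> e / 2"
        using \<open>e > 0\<close> unfolding ell2_hdist[OF X lC] by (intro real_le_lsqrt) auto
      then show ?thesis using \<open>e > 0\<close> by simp
    qed
    moreover have "0 \<le> hdist (ell2 I) (X n) l" for n
      by (simp add: ell2_hdist X lC infsum_nonneg)
    ultimately show "\<exists>N. \<forall>n\<ge>N. norm (hdist (ell2 I) (X n) l - 0) < e" by auto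
  qed
  then show ?thesis using lC by blast
qed

lemma ell2_hilbert: "complex_hilbert_space (ell2 I)"
proof
  show "x = hzero (ell2 I)" if x: "x \<in> hcarrier (ell2 I)" and 0: "hinner (ell2 I) x x = 0" for x
  proof -
    have inf0: "(\<Sum>\<^sub>\<infinity>g\<in>I. (cmod (x g))\<^sup>2) = 0"
      using 0 ell2_inner_self[OF x] by (simp only: of_real_eq_0_iff)
    have "x g = 0" for g
    proof (cases "g \<in> I")
      case True
      then show ?thesis
        using nonneg_infsum_le_0D[of "\<lambda>g. (cmod (x g))\<^sup>2" I g] inf0 x by (simp add: ell2_carrier_iff)
    qed (use x in \<open>simp add: ell2_carrier_iff\<close>)
    then show ?thesis by auto
  qed
  show "\<exists>l\<in>hcarrier (ell2 I). (\<lambda>n. hdist (ell2 I) (X n) l) \<longlonglongrightarrow> 0"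
    if "\<And>n. X n \<in> hcarrier (ell2 I)"
      "\<forall>e>0. \<exists>N. \<forall>m\<ge>N. \<forall>n\<ge>N. hdist (ell2 I) (X m) (X n) < e" for X
    using ell2_complete[OF that] .
  show "0 \<le> Re (hinner (ell2 I) x x)" if "x \<in> hcarrier (ell2 I)" for x
    using that by (simp add: ell2_inner_self infsum_nonneg)
  show "hinner (ell2 I) x y = cnj (hinner (ell2 I) y x)" for x y
    by (simp add: ell2_inner mult.commute flip: infsum_cnj)
  show "hinner (ell2 I) x (hadd (ell2 I) y z) = hinner (ell2 I) x y + hinner (ell2 I) x z"
    if "x \<in> hcarrier (ell2 I)" "y \<in> hcarrier (ell2 I)" "z \<in> hcarrier (ell2 I)" for x y z
    using that by (simp add: ell2_inner distrib_left infsum_add ell2_inner_summable)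
  show "hinner (ell2 I) x (hscale (ell2 I) c y) = c * hinner (ell2 I) x y" for x y c
    by (simp add: ell2_inner mult.left_commute infsum_cmult_right')
  show "hzero (ell2 I) \<in> hcarrier (ell2 I)" by (simp add: ell2_carrier_iff)
qed (auto simp: fun_eq_iff algebra_simps intro: ell2_add_closed ell2_scale_closed)

lemma ket_carrier: "g \<in> I \<Longrightarrow> ket g \<in> hcarrier (ell2 I)"
  unfolding ell2_carrier_iff ket_def
  by (auto intro!: finite_nonzero_values_imp_summable_on intro: finite_subset[of _ "{g}"])

lemma ell2_inner_ket:
  assumes "g \<in> I"
  shows "hinner (ell2 I) (ket g) f = f g"
proof -
  have "hinner (ell2 I) (ket g) f = (\<Sum>\<^sub>\<infinity>h\<in>{g}. f h)"
    unfolding ell2_inner using assms by (intro infsum_cong_neutral) (auto simp: ket_def)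
  then show ?thesis by simp
qed

text \<open>Coordinates are inner products with basis vectors, hence measurable, and over a
  countable index set the inner product is a series of products of coordinates. This discharges the
  second assumption of \<open>L2_space\<close>.\<close>

lemma ell2_inner_measurable:
  fixes I :: "'g set"
  assumes I: "countable I"
    and carr: "\<And>x. x \<in> space M \<Longrightarrow> \<xi> x \<in> hcarrier (ell2 I)" "\<And>x. x \<in> space M \<Longrightarrow> \<eta> x \<in> hcarrier (ell2 I)"
    and meas: "\<And>k. k \<in> hcarrier (ell2 I) \<Longrightarrow> (\<lambda>x. hinner (ell2 I) k (\<xi> x)) \<in> borel_measurable M"
      "\<And>k. k \<in> hcarrier (ell2 I) \<Longrightarrow> (\<lambda>x. hinner (ell2 I) k (\<eta> x)) \<in> borel_measurable M"
  shows "(\<lambda>x. hinner (ell2 I) (\<xi> x) (\<eta> x)) \<in> borel_measurable M"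
proof -
  have coord [measurable]: "(\<lambda>x. \<xi> x g) \<in> borel_measurable M" "(\<lambda>x. \<eta> x g) \<in> borel_measurable M"
    if "g \<in> I" for g
    using meas[OF ket_carrier[OF that]] that by (simp_all add: ell2_inner_ket)
  \<comment> \<open>\<open>J\<close> consists of the codes of elements of \<open>I\<close>. Since
    \<open>F\<close> is 0 off \<open>J\<close>, finite and infinite index sets are both covered by a
    series over all naturals.\<close>
  define J where "J = to_nat_on I ` I"
  define F where "F x n = (if n \<in> J then cnj (\<xi> x (from_nat_into I n)) * \<eta> x (from_nat_into I n) else 0)"
    for x n
  have inI: "from_nat_into I n \<in> I" if "n \<in> J" for n
    using that I by (auto simp: J_def)
  have "F x sums hinner (ell2 I) (\<xi> x) (\<eta> x)" if x: "x \<in> space M" for x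
  proof (rule has_sum_imp_sums)
    let ?h = "\<lambda>g. cnj (\<xi> x g) * \<eta> x g"
    have "(?h has_sum hinner (ell2 I) (\<xi> x) (\<eta> x)) I"
      using ell2_inner_summable[OF carr[OF x]] by (simp add: ell2_inner)
    then have "((F x \<circ> to_nat_on I) has_sum hinner (ell2 I) (\<xi> x) (\<eta> x)) I"
      by (rule has_sum_cong[THEN iffD1, rotated]) (use I in \<open>simp add: F_def J_def\<close>)
    then have "(F x has_sum hinner (ell2 I) (\<xi> x) (\<eta> x)) J"
      unfolding J_def by (subst has_sum_reindex) (use I in auto)
    then show "(F x has_sum hinner (ell2 I) (\<xi> x) (\<eta> x)) UNIV"
      by (rule has_sum_cong_neutral[THEN iffD1, rotated -1]) (auto simp: F_def)
  qed
  then have "hinner (ell2 I) (\<xi> x) (\<eta> x) = (\<Sum>n. F x n)" if "x \<in> space M" for x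
    using that by (simp add: sums_iff)
  moreover have "(\<lambda>x. \<Sum>n. F x n) \<in> borel_measurable M"
  proof (rule borel_measurable_suminf)
    show "(\<lambda>x. F x n) \<in> borel_measurable M" for n
      using inI[of n] coord[of "from_nat_into I n"] unfolding F_def
      by (cases "n \<in> J") (auto intro!: borel_measurable_times
          borel_measurable_continuous_on[of cnj] continuous_intros)
  qed
  ultimately show ?thesis by (subst measurable_cong) auto
qed

section \<open>Square integrable functions with values in a Hilbert space\<close>

text \<open>Summable steps make the sequence Cauchy; \<open>L2_complete\<close> applies this
  pointwise.\<close>

lemma (in complex_hilbert_space) summable_hdist_limit:
  assumes X: "\<And>n. X n \<in> hcarrier H" and sum: "summable (\<lambda>k. hdist H (X (Suc k)) (X k))"
  shows "\<exists>l\<in>hcarrier H. (\<lambda>n. hdist H (X n) l) \<longlonglongrightarrow> 0"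
proof (rule complete[OF X], intro allI impI)
  fix e :: real assume "e > 0"
  then obtain N where N: "\<And>m n. m \<ge> N \<Longrightarrow> norm (\<Sum>k=m..<n. hdist H (X (Suc k)) (X k)) < e"
    using sum unfolding summable_Cauchy by blast
  have step: "hdist H (X (m + j)) (X m) \<le> (\<Sum>k=m..<m+j. hdist H (X (Suc k)) (X k))" for m j
  proof (induction j)
    case (Suc j)
    then show ?case using hdist_triangle[of "X (m + Suc j)" "X (m + j)" "X m"] X by simp
  qed (simp add: hdist_self X)
  have less: "hdist H (X n) (X m) < e" if "m \<ge> N" "n \<ge> m" for m n
    using step[of m "n - m"] N[OF \<open>m \<ge> N\<close>, of n] \<open>n \<ge> m\<close> by simp
  have "hdist H (X m) (X n) < e" if "m \<ge> N" "n \<ge> N" for m n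
    using less[of m n] less[of n m] that hdist_commute[OF X X, of m n] by (cases "n \<ge> m") auto
  then show "\<exists>N. \<forall>m\<ge>N. \<forall>n\<ge>N. hdist H (X m) (X n) < e" by blast
qed

text \<open>\<open>sq_int\<close> demands weak measurability only, and for a non-separable
  \<open>K\<close> this need not make the inner product of two functions measurable. Hence that
  property is an assumption here, verified later for \<open>ell2\<close> over a countable
  set.\<close>

locale L2_space =
  fixes M :: "'x measure" and K :: "'k hilb"
  assumes hilbert: "complex_hilbert_space K"
    and inner_measurable: "\<And>\<xi> \<eta>. \<lbrakk>\<And>x. x \<in> space M \<Longrightarrow> \<xi> x \<in> hcarrier K; \<And>x. x \<in> space M \<Longrightarrow> \<eta> x \<in> hcarrier K;
        \<And>k. k \<in> hcarrier K \<Longrightarrow> (\<lambda>x. hinner K k (\<xi> x)) \<in> borel_measurable M;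
        \<And>k. k \<in> hcarrier K \<Longrightarrow> (\<lambda>x. hinner K k (\<eta> x)) \<in> borel_measurable M\<rbrakk> \<Longrightarrow>
      (\<lambda>x. hinner K (\<xi> x) (\<eta> x)) \<in> borel_measurable M"
begin

sublocale K: complex_hilbert_space K by (rule hilbert)

section \<open>Weakly measurable functions\<close>

definition weakly_measurable :: "('x \<Rightarrow> 'k) \<Rightarrow> bool" where
  "weakly_measurable \<xi> \<longleftrightarrow> (\<forall>x\<in>space M. \<xi> x \<in> hcarrier K) \<and>
     (\<forall>k\<in>hcarrier K. (\<lambda>x. hinner K k (\<xi> x)) \<in> borel_measurable M)"

lemma weakly_measurable_carrier: "\<lbrakk>weakly_measurable \<xi>; x \<in> space M\<rbrakk> \<Longrightarrow> \<xi> x \<in> hcarrier K"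
  by (simp add: weakly_measurable_def)

lemma weakly_measurable_inner:
  "\<lbrakk>weakly_measurable \<xi>; weakly_measurable \<eta>\<rbrakk> \<Longrightarrow> (\<lambda>x. hinner K (\<xi> x) (\<eta> x)) \<in> borel_measurable M"
  by (rule inner_measurable) (auto simp: weakly_measurable_def)

lemma weakly_measurable_hnorm:
  assumes "weakly_measurable \<xi>"
  shows "(\<lambda>x. hnorm K (\<xi> x)) \<in> borel_measurable M"
  unfolding hnorm_def using weakly_measurable_inner[OF assms assms] by measurable

lemma weakly_measurable_add:
  assumes "weakly_measurable \<xi>" "weakly_measurable \<eta>"
  shows "weakly_measurable (\<lambda>x. hadd K (\<xi> x) (\<eta> x))"
  unfolding weakly_measurable_def
proof (intro conjI ballI)
  fix k assume k: "k \<in> hcarrier K"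
  have "(\<lambda>x. hinner K k (\<xi> x) + hinner K k (\<eta> x)) \<in> borel_measurable M"
    using assms k by (auto simp: weakly_measurable_def intro: borel_measurable_add)
  then show "(\<lambda>x. hinner K k (hadd K (\<xi> x) (\<eta> x))) \<in> borel_measurable M"
    by (rule measurable_cong[THEN iffD1, rotated])
      (use assms k in \<open>simp add: K.inner_add_right weakly_measurable_carrier\<close>)
qed (use assms in \<open>simp add: K.add_closed weakly_measurable_carrier\<close>)

lemma weakly_measurable_scale:
  assumes "weakly_measurable \<xi>"
  shows "weakly_measurable (\<lambda>x. hscale K c (\<xi> x))"
  unfolding weakly_measurable_def
proof (intro conjI ballI)
  fix k assume k: "k \<in> hcarrier K"
  have "(\<lambda>x. c * hinner K k (\<xi> x)) \<in> borel_measurable M"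
    using assms k by (auto simp: weakly_measurable_def)
  then show "(\<lambda>x. hinner K k (hscale K c (\<xi> x))) \<in> borel_measurable M"
    by (rule measurable_cong[THEN iffD1, rotated])
      (use assms k in \<open>simp add: K.inner_scale_right weakly_measurable_carrier\<close>)
qed (use assms in \<open>simp add: K.scale_closed weakly_measurable_carrier\<close>)

lemma weakly_measurable_const: "k \<in> hcarrier K \<Longrightarrow> weakly_measurable (\<lambda>x. k)"
  by (simp add: weakly_measurable_def)

text \<open>Cutting off to a measurable set serves twice: it removes an exceptional null set in
  \<open>L2_complete\<close>, and it splits a constant function according to the first
  letter.\<close>

lemma weakly_measurable_if:
  assumes "weakly_measurable \<xi>" and A: "A \<in> sets M"
  shows "weakly_measurable (\<lambda>x. if x \<in> A then \<xi> x else hzero K)"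
  unfolding weakly_measurable_def
proof (intro conjI ballI)
  fix k assume k: "k \<in> hcarrier K"
  have [measurable]: "(\<lambda>x. hinner K k (\<xi> x)) \<in> borel_measurable M"
    using assms k by (simp add: weakly_measurable_def)
  have "(\<lambda>x. if x \<in> A then hinner K k (\<xi> x) else 0) \<in> borel_measurable M"
    using A by measurable
  then show "(\<lambda>x. hinner K k (if x \<in> A then \<xi> x else hzero K)) \<in> borel_measurable M"
    by (rule measurable_cong[THEN iffD1, rotated]) (use k in \<open>simp add: K.inner_zero_right\<close>)
qed (use assms in \<open>simp add: K.zero_closed weakly_measurable_carrier\<close>)

lemma weakly_measurable_limit:
  assumes X: "\<And>n. weakly_measurable (X n)"
    and f: "\<And>x. x \<in> space M \<Longrightarrow> f x \<in> hcarrier K"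
    and lim: "\<And>x. x \<in> space M \<Longrightarrow> (\<lambda>n. hdist K (X n x) (f x)) \<longlonglongrightarrow> 0"
  shows "weakly_measurable f"
  unfolding weakly_measurable_def
proof (intro conjI ballI f)
  fix k assume k: "k \<in> hcarrier K"
  show "(\<lambda>x. hinner K k (f x)) \<in> borel_measurable M"
  proof (rule borel_measurable_LIMSEQ_metric)
    show "(\<lambda>x. hinner K k (X n x)) \<in> borel_measurable M" for n
      using X k by (simp add: weakly_measurable_def)
    show "(\<lambda>n. hinner K k (X n x)) \<longlonglongrightarrow> hinner K k (f x)" if "x \<in> space M" for x
      using that by (intro K.inner_tendsto k f lim weakly_measurable_carrier[OF X])
  qed
qed

lemma weakly_measurable_hdist:
  "\<lbrakk>weakly_measurable \<xi>; weakly_measurable \<eta>\<rbrakk> \<Longrightarrow> (\<lambda>x. hdist K (\<xi> x) (\<eta> x)) \<in> borel_measurable M"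
  unfolding hdist_def by (intro weakly_measurable_hnorm weakly_measurable_add weakly_measurable_scale)

section \<open>Square integrable functions\<close>

lemma sq_int_iff:
  "\<xi> \<in> sq_int M K \<longleftrightarrow> weakly_measurable \<xi> \<and> integrable M (\<lambda>x. (hnorm K (\<xi> x))\<^sup>2)"
  by (auto simp: sq_int_def weakly_measurable_def)

lemma sq_int_carrier: "\<lbrakk>\<xi> \<in> sq_int M K; x \<in> space M\<rbrakk> \<Longrightarrow> \<xi> x \<in> hcarrier K"
  by (simp add: sq_int_def)

lemma sq_int_add:
  assumes \<xi>: "\<xi> \<in> sq_int M K" and \<eta>: "\<eta> \<in> sq_int M K"
  shows "(\<lambda>x. hadd K (\<xi> x) (\<eta> x)) \<in> sq_int M K"
proof -
  have wm: "weakly_measurable (\<lambda>x. hadd K (\<xi> x) (\<eta> x))"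
    using assms by (simp add: sq_int_iff weakly_measurable_add)
  have "integrable M (\<lambda>x. (hnorm K (hadd K (\<xi> x) (\<eta> x)))\<^sup>2)"
  proof (rule Bochner_Integration.integrable_bound)
    show "integrable M (\<lambda>x. 2 * (hnorm K (\<xi> x))\<^sup>2 + 2 * (hnorm K (\<eta> x))\<^sup>2)"
      using assms by (simp add: sq_int_iff)
    show "(\<lambda>x. (hnorm K (hadd K (\<xi> x) (\<eta> x)))\<^sup>2) \<in> borel_measurable M"
      using weakly_measurable_hnorm[OF wm] by measurable
    show "AE x in M. norm ((hnorm K (hadd K (\<xi> x) (\<eta> x)))\<^sup>2) \<le>
        norm (2 * (hnorm K (\<xi> x))\<^sup>2 + 2 * (hnorm K (\<eta> x))\<^sup>2)"
      by (rule AE_I2) (use K.hnorm_add_sq_le sq_int_carrier assms in simp)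
  qed
  with wm show ?thesis by (simp add: sq_int_iff)
qed

lemma sq_int_scale:
  assumes \<xi>: "\<xi> \<in> sq_int M K"
  shows "(\<lambda>x. hscale K c (\<xi> x)) \<in> sq_int M K"
proof -
  have "integrable M (\<lambda>x. (cmod c)\<^sup>2 * (hnorm K (\<xi> x))\<^sup>2)"
    using \<xi> by (simp add: sq_int_iff)
  moreover have "(hnorm K (hscale K c (\<xi> x)))\<^sup>2 = (cmod c)\<^sup>2 * (hnorm K (\<xi> x))\<^sup>2" if "x \<in> space M" for x
    using sq_int_carrier[OF \<xi> that] by (simp add: K.hnorm_scale power_mult_distrib)
  ultimately have "integrable M (\<lambda>x. (hnorm K (hscale K c (\<xi> x)))\<^sup>2)"
    by (subst Bochner_Integration.integrable_cong[OF refl]) auto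
  then show ?thesis using \<xi> by (simp add: sq_int_iff weakly_measurable_scale)
qed

lemma sq_int_zero: "(\<lambda>x. hzero K) \<in> sq_int M K"
  by (simp add: sq_int_iff weakly_measurable_const K.zero_closed K.hnorm_zero)

lemma sq_int_cong:
  assumes "\<And>x. x \<in> space M \<Longrightarrow> \<xi> x = \<eta> x"
  shows "\<xi> \<in> sq_int M K \<longleftrightarrow> \<eta> \<in> sq_int M K"
proof -
  have "(\<lambda>x. hinner K k (\<xi> x)) \<in> borel_measurable M \<longleftrightarrow> (\<lambda>x. hinner K k (\<eta> x)) \<in> borel_measurable M" for k
    using assms by (intro measurable_cong) simp
  moreover have "integrable M (\<lambda>x. (hnorm K (\<xi> x))\<^sup>2) \<longleftrightarrow> integrable M (\<lambda>x. (hnorm K (\<eta> x))\<^sup>2)"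
    using assms by (intro Bochner_Integration.integrable_cong) auto
  ultimately show ?thesis using assms by (simp add: sq_int_def)
qed

section \<open>Almost everywhere classes and the operations on them\<close>

abbreviation cl :: "('x \<Rightarrow> 'k) \<Rightarrow> ('x \<Rightarrow> 'k) set" where "cl \<equiv> ae_class M K"

text \<open>No integrability is assumed: \<open>ae_class\<close> collects the square integrable
  functions that agree with \<xi> almost everywhere, so it depends on \<xi> only up to null sets
  even when \<xi> itself lies outside \<open>sq_int\<close>. The definitions of \<open>hadd\<close>,
  \<open>hscale\<close> and \<open>T_op\<close> apply it to such unchecked functions.\<close>

lemma cl_cong: "AE x in M. \<xi> x = \<eta> x \<Longrightarrow> cl \<xi> = cl \<eta>"
  unfolding ae_class_def by (intro Collect_cong conj_cong refl iffI) (auto elim: AE_mp)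

lemma cl_eqI: "(\<And>x. x \<in> space M \<Longrightarrow> \<xi> x = \<eta> x) \<Longrightarrow> cl \<xi> = cl \<eta>"
  by (rule cl_cong) simp

lemma self_in_cl: "\<xi> \<in> sq_int M K \<Longrightarrow> \<xi> \<in> cl \<xi>"
  by (simp add: ae_class_def)

lemma rep_cl_nonempty:
  assumes "cl \<xi> \<noteq> {}"
  shows "rep (cl \<xi>) \<in> sq_int M K" "AE x in M. rep (cl \<xi>) x = \<xi> x"
proof -
  have "rep (cl \<xi>) \<in> cl \<xi>" using assms by (simp add: rep_def some_in_eq)
  then show "rep (cl \<xi>) \<in> sq_int M K" "AE x in M. rep (cl \<xi>) x = \<xi> x"
    by (simp_all add: ae_class_def)
qed

lemma rep_cl:
  assumes "\<xi> \<in> sq_int M K"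
  shows "rep (cl \<xi>) \<in> sq_int M K" "AE x in M. rep (cl \<xi>) x = \<xi> x"
  using rep_cl_nonempty[of \<xi>] self_in_cl[OF assms] by auto

lemma L2_carrier: "hcarrier (L2 M K) = cl ` sq_int M K"
  by (simp add: L2_def)

lemma L2_carrierI: "\<xi> \<in> sq_int M K \<Longrightarrow> cl \<xi> \<in> hcarrier (L2 M K)"
  by (simp add: L2_carrier)

lemma L2_zero: "hzero (L2 M K) = cl (\<lambda>x. hzero K)"
  by (simp add: L2_def)

lemma L2_add:
  assumes "\<xi> \<in> sq_int M K" "\<eta> \<in> sq_int M K"
  shows "hadd (L2 M K) (cl \<xi>) (cl \<eta>) = cl (\<lambda>x. hadd K (\<xi> x) (\<eta> x))"
proof -
  have "AE x in M. hadd K (rep (cl \<xi>) x) (rep (cl \<eta>) x) = hadd K (\<xi> x) (\<eta> x)"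
    using rep_cl(2)[OF assms(1)] rep_cl(2)[OF assms(2)] by eventually_elim simp
  then show ?thesis by (simp add: L2_def cl_cong)
qed

lemma L2_scale:
  assumes "\<xi> \<in> sq_int M K"
  shows "hscale (L2 M K) c (cl \<xi>) = cl (\<lambda>x. hscale K c (\<xi> x))"
proof -
  have "AE x in M. hscale K c (rep (cl \<xi>) x) = hscale K c (\<xi> x)"
    using rep_cl(2)[OF assms] by eventually_elim simp
  then show ?thesis by (simp add: L2_def cl_cong)
qed

lemma L2_inner:
  assumes "\<xi> \<in> sq_int M K" "\<eta> \<in> sq_int M K"
  shows "hinner (L2 M K) (cl \<xi>) (cl \<eta>) = (\<integral>x. hinner K (\<xi> x) (\<eta> x) \<partial>M)"
proof -
  have "AE x in M. hinner K (rep (cl \<xi>) x) (rep (cl \<eta>) x) = hinner K (\<xi> x) (\<eta> x)"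
    using rep_cl(2)[OF assms(1)] rep_cl(2)[OF assms(2)] by eventually_elim simp
  then show ?thesis
    using assms rep_cl(1) by (simp add: L2_def integral_cong_AE weakly_measurable_inner sq_int_iff)
qed

lemma sq_int_inner_integrable:
  assumes "\<xi> \<in> sq_int M K" "\<eta> \<in> sq_int M K"
  shows "integrable M (\<lambda>x. hinner K (\<xi> x) (\<eta> x))"
proof (rule Bochner_Integration.integrable_bound)
  show "integrable M (\<lambda>x. (hnorm K (\<xi> x))\<^sup>2 + (hnorm K (\<eta> x))\<^sup>2)"
    using assms by (simp add: sq_int_iff)
  show "(\<lambda>x. hinner K (\<xi> x) (\<eta> x)) \<in> borel_measurable M"
    using assms by (simp add: sq_int_iff weakly_measurable_inner)
  show "AE x in M. norm (hinner K (\<xi> x) (\<eta> x)) \<le> norm ((hnorm K (\<xi> x))\<^sup>2 + (hnorm K (\<eta> x))\<^sup>2)"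
    by (rule AE_I2) (use K.cmod_inner_le sq_int_carrier assms in simp)
qed

lemma L2_inner_self:
  assumes "\<xi> \<in> sq_int M K"
  shows "hinner (L2 M K) (cl \<xi>) (cl \<xi>) = complex_of_real (\<integral>x. (hnorm K (\<xi> x))\<^sup>2 \<partial>M)"
proof -
  have "hinner (L2 M K) (cl \<xi>) (cl \<xi>) = (\<integral>x. complex_of_real ((hnorm K (\<xi> x))\<^sup>2) \<partial>M)"
    unfolding L2_inner[OF assms assms]
    by (intro Bochner_Integration.integral_cong refl K.inner_self sq_int_carrier[OF assms])
  then show ?thesis by (simp only: integral_complex_of_real)
qed

lemma L2_sub:
  assumes "\<xi> \<in> sq_int M K" "\<eta> \<in> sq_int M K"
  shows "hadd (L2 M K) (cl \<xi>) (hscale (L2 M K) (-1) (cl \<eta>)) = cl (\<lambda>x. hadd K (\<xi> x) (hscale K (-1) (\<eta> x)))"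
  using assms by (simp add: L2_add L2_scale sq_int_scale)

lemma sq_int_sub:
  "\<lbrakk>\<xi> \<in> sq_int M K; \<eta> \<in> sq_int M K\<rbrakk> \<Longrightarrow> (\<lambda>x. hadd K (\<xi> x) (hscale K (-1) (\<eta> x))) \<in> sq_int M K"
  by (simp add: sq_int_add sq_int_scale)

text \<open>The squared distance is expressed as a nonnegative integral because the exchange of
  series and integral and Fatou's lemma work there before integrability of the limit is
  known.\<close>

lemma L2_hdist:
  assumes "\<xi> \<in> sq_int M K" "\<eta> \<in> sq_int M K"
  shows "0 \<le> hdist (L2 M K) (cl \<xi>) (cl \<eta>)"
    and "ennreal ((hdist (L2 M K) (cl \<xi>) (cl \<eta>))\<^sup>2) = (\<integral>\<^sup>+x. ennreal ((hdist K (\<xi> x) (\<eta> x))\<^sup>2) \<partial>M)"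
proof -
  have hd: "hdist (L2 M K) (cl \<xi>) (cl \<eta>) = sqrt (\<integral>x. (hdist K (\<xi> x) (\<eta> x))\<^sup>2 \<partial>M)"
    unfolding hdist_def L2_sub[OF assms] hnorm_def[of "L2 M K"] L2_inner_self[OF sq_int_sub[OF assms]]
    by simp
  then show "0 \<le> hdist (L2 M K) (cl \<xi>) (cl \<eta>)" by simp
  have "(\<integral>\<^sup>+x. ennreal ((hdist K (\<xi> x) (\<eta> x))\<^sup>2) \<partial>M) = ennreal (\<integral>x. (hdist K (\<xi> x) (\<eta> x))\<^sup>2 \<partial>M)"
    using sq_int_sub[OF assms] by (intro nn_integral_eq_integral) (auto simp: sq_int_iff hdist_def)
  then show "ennreal ((hdist (L2 M K) (cl \<xi>) (cl \<eta>))\<^sup>2) = (\<integral>\<^sup>+x. ennreal ((hdist K (\<xi> x) (\<eta> x))\<^sup>2) \<partial>M)"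
    by (simp add: hd)
qed

text \<open>Here f = (f - \<xi>) + \<xi>. In this way a pointwise limit at finite distance from a
  square integrable function is recognized as square integrable.\<close>

lemma sq_int_of_hdist:
  assumes \<xi>: "\<xi> \<in> sq_int M K" and f: "weakly_measurable f"
    and fin: "(\<integral>\<^sup>+x. ennreal ((hdist K (f x) (\<xi> x))\<^sup>2) \<partial>M) < \<infinity>"
  shows "f \<in> sq_int M K"
proof -
  have wm: "weakly_measurable \<xi>" using \<xi> by (simp add: sq_int_iff)
  have "integrable M (\<lambda>x. (hdist K (f x) (\<xi> x))\<^sup>2)"
    using fin weakly_measurable_hdist[OF f wm] by (simp add: integrable_iff_bounded)
  then have "(\<lambda>x. hadd K (f x) (hscale K (-1) (\<xi> x))) \<in> sq_int M K"
    using f wm by (simp add: sq_int_iff hdist_def weakly_measurable_add weakly_measurable_scale)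
  from sq_int_add[OF this \<xi>] show ?thesis
    by (rule sq_int_cong[THEN iffD1, rotated])
      (simp add: K.sub_add_cancel weakly_measurable_carrier[OF f] weakly_measurable_carrier[OF wm])
qed

text \<open>The Riesz-Fischer argument: a rapidly converging subsequence has a pointwise limit
  almost everywhere, and Fatou's lemma compares the original sequence with that limit.\<close>

lemma L2_complete:
  assumes X: "\<And>n::nat. X n \<in> hcarrier (L2 M K)"
    and Cauchy: "\<forall>e>0. \<exists>N. \<forall>m\<ge>N. \<forall>n\<ge>N. hdist (L2 M K) (X m) (X n) < e"
  shows "\<exists>l\<in>hcarrier (L2 M K). (\<lambda>n. hdist (L2 M K) (X n) l) \<longlonglongrightarrow> 0"
proof -
  have "\<forall>n. \<exists>\<xi>. \<xi> \<in> sq_int M K \<and> X n = cl \<xi>" using X by (auto simp: L2_carrier)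
  then obtain F where F: "\<And>n. F n \<in> sq_int M K" and XF: "\<And>n. X n = cl (F n)" by metis
  have "\<forall>j. \<exists>N. \<forall>m\<ge>N. \<forall>n\<ge>N. hdist (L2 M K) (X m) (X n) < (1 / 2) ^ j"
    using Cauchy by simp
  then obtain N where N: "\<And>j m n. m \<ge> N j \<Longrightarrow> n \<ge> N j \<Longrightarrow> hdist (L2 M K) (X m) (X n) < (1 / 2) ^ j"
    by metis
  \<comment> \<open>The sum dominates every \<open>N j\<close> with j \<le> k, so \<open>r k\<close>
    and \<open>r (Suc k)\<close> both lie beyond \<open>N k\<close>.\<close>
  define r where "r k = (\<Sum>i\<le>k. N i)" for k :: nat
  have rN: "N j \<le> r k" if "j \<le> k" for j k
    unfolding r_def using that by (intro member_le_sum) auto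
  have wmF: "weakly_measurable (F n)" for n using F[of n] by (simp add: sq_int_iff)
  define D where "D k x = hdist K (F (r (Suc k)) x) (F (r k) x)" for k x
  have D [measurable]: "D k \<in> borel_measurable M" for k
    unfolding D_def by (intro weakly_measurable_hdist wmF)
  \<comment> \<open>Since \<open>D\<^sub>k \<le> 2\<^sup>-\<^sup>k + 2\<^sup>k D\<^sub>k\<^sup>2\<close>, finiteness of \<open>S x\<close> makes \<open>D\<^sub>k x\<close> summable; no finiteness of the
    measure is needed.\<close>
  define S where "S x = (\<Sum>k. ennreal (2 ^ k * (D k x)\<^sup>2))" for x
  have S [measurable]: "S \<in> borel_measurable M" unfolding S_def by measurable
  have "(\<integral>\<^sup>+x. S x \<partial>M) = (\<Sum>k. \<integral>\<^sup>+x. ennreal (2 ^ k * (D k x)\<^sup>2) \<partial>M)"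
    unfolding S_def by (intro nn_integral_suminf) measurable
  also have "\<dots> \<le> (\<Sum>k. ennreal ((1 / 2) ^ k))"
  proof (intro suminf_le allI)
    fix k
    have "(\<integral>\<^sup>+x. ennreal (2 ^ k * (D k x)\<^sup>2) \<partial>M) = ennreal (2 ^ k) * (\<integral>\<^sup>+x. ennreal ((D k x)\<^sup>2) \<partial>M)"
      by (simp add: ennreal_mult' nn_integral_cmult)
    also have "\<dots> = ennreal (2 ^ k * (hdist (L2 M K) (X (r (Suc k))) (X (r k)))\<^sup>2)"
      unfolding D_def XF L2_hdist(2)[OF F F, symmetric] by (simp add: ennreal_mult')
    also have "\<dots> \<le> ennreal ((1 / 2) ^ k)"
    proof (rule ennreal_leI)
      have "(hdist (L2 M K) (X (r (Suc k))) (X (r k)))\<^sup>2 \<le> ((1 / 2) ^ k)\<^sup>2"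
        using L2_hdist(1)[OF F F] N[OF rN rN, of k "Suc k" k] by (intro power_mono) (auto simp: XF)
      then have "2 ^ k * (hdist (L2 M K) (X (r (Suc k))) (X (r k)))\<^sup>2 \<le> 2 ^ k * ((1 / 2) ^ k)\<^sup>2"
        by (intro mult_left_mono) auto
      also have "\<dots> = (1 / 2) ^ k" by (simp add: power2_eq_square power_one_over)
      finally show "2 ^ k * (hdist (L2 M K) (X (r (Suc k))) (X (r k)))\<^sup>2 \<le> (1 / 2) ^ k" .
    qed
    finally show "(\<integral>\<^sup>+x. ennreal (2 ^ k * (D k x)\<^sup>2) \<partial>M) \<le> ennreal ((1 / 2) ^ k)" .
  qed auto
  also have "\<dots> = ennreal 2"
    using geometric_sums[of "1 / 2 :: real"] by (intro suminf_ennreal_eq) auto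
  finally have "(\<integral>\<^sup>+x. S x \<partial>M) \<noteq> \<infinity>" by (auto simp: top_unique)
  then have AES: "AE x in M. S x \<noteq> \<infinity>" by (rule nn_integral_PInf_AE[OF S])
  define G where "G = {x \<in> space M. S x \<noteq> \<infinity>}"
  have G: "G \<in> sets M" unfolding G_def by measurable
  have AEG: "AE x in M. x \<in> G" using AES AE_space by eventually_elim (simp add: G_def)
  have "\<exists>l\<in>hcarrier K. (\<lambda>k. hdist K (F (r k) x) l) \<longlonglongrightarrow> 0" if x: "x \<in> G" for x
  proof (rule K.summable_hdist_limit)
    have xM: "x \<in> space M" using x by (simp add: G_def)
    then show "F (r k) x \<in> hcarrier K" for k by (rule sq_int_carrier[OF F])
    have "summable (\<lambda>k. 2 ^ k * (D k x)\<^sup>2)"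
      using x by (intro summable_suminf_not_top) (auto simp: G_def S_def)
    then have sum: "summable (\<lambda>k. (1 / 2) ^ k + 2 ^ k * (D k x)\<^sup>2)"
      by (intro summable_add summable_geometric) auto
    have "norm (D k x) \<le> (1 / 2) ^ k + 2 ^ k * (D k x)\<^sup>2" for k
    proof -
      have "0 \<le> D k x" unfolding D_def using xM by (intro K.hdist_nonneg sq_int_carrier[OF F])
      moreover have "D k x \<le> (1 / 2) ^ k + 2 ^ k * (D k x)\<^sup>2"
      \<comment> \<open>Below the threshold the geometric term suffices. Above it the factor 2^k D
        is at least 1, and the quadratic term dominates.\<close>
      proof (cases "D k x \<le> (1 / 2) ^ k")
        case True
        then show ?thesis by (simp add: add_increasing2)
      next
        case False
        then have "1 \<le> 2 ^ k * D k x" by (simp add: power_one_over field_simps)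
        then have "D k x * 1 \<le> D k x * (2 ^ k * D k x)"
          using \<open>0 \<le> D k x\<close> by (intro mult_left_mono)
        then show ?thesis by (simp add: power2_eq_square mult_ac add_increasing)
      qed
      ultimately show ?thesis by simp
    qed
    then have "summable (\<lambda>k. D k x)" by (intro summable_comparison_test'[OF sum, of 0]) auto
    then show "summable (\<lambda>k. hdist K (F (r (Suc k)) x) (F (r k) x))" by (simp add: D_def)
  qed
  then have "\<forall>x. \<exists>l. x \<in> G \<longrightarrow> l \<in> hcarrier K \<and> (\<lambda>k. hdist K (F (r k) x) l) \<longlonglongrightarrow> 0" by blast
  then obtain l where l: "\<And>x. x \<in> G \<Longrightarrow> l x \<in> hcarrier K"
    "\<And>x. x \<in> G \<Longrightarrow> (\<lambda>k. hdist K (F (r k) x) (l x)) \<longlonglongrightarrow> 0" by metis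
  \<comment> \<open>\<open>G\<close> has full measure, so the value off \<open>G\<close> does not
    affect the class; zero keeps \<open>f\<close> in the carrier everywhere and weakly
    measurable.\<close>
  define f where "f x = (if x \<in> G then l x else hzero K)" for x
  have fC: "f x \<in> hcarrier K" for x using l by (simp add: f_def K.zero_closed)
  have f: "weakly_measurable f"
  proof (rule weakly_measurable_limit)
    show "weakly_measurable (\<lambda>x. if x \<in> G then F (r k) x else hzero K)" for k
      by (intro weakly_measurable_if wmF G)
    show "(\<lambda>k. hdist K (if x \<in> G then F (r k) x else hzero K) (f x)) \<longlonglongrightarrow> 0" for x
      using l by (cases "x \<in> G") (auto simp: f_def K.hdist_self K.zero_closed)
  qed (rule fC)
  \<comment> \<open>One estimate with two uses: at \<open>j\<close> = 0 it puts \<open>f\<close> at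
    finite distance from a square integrable function, and for large \<open>j\<close> it gives
    convergence.\<close>
  have bound: "(\<integral>\<^sup>+x. ennreal ((hdist K (F n x) (f x))\<^sup>2) \<partial>M) \<le> ennreal (((1 / 2) ^ j)\<^sup>2)"
    if n: "n \<ge> N j" for n j
  proof -
    \<comment> \<open>The limit exists almost everywhere and so equals the liminf, the form in which
      Fatou's lemma applies.\<close>
    have "AE x in M. ennreal ((hdist K (F n x) (f x))\<^sup>2) =
        liminf (\<lambda>k. ennreal ((hdist K (F n x) (F (r k) x))\<^sup>2))"
      using AEG
    proof eventually_elim
      case (elim x)
      then have x: "x \<in> space M" by (simp add: G_def)
      have "(\<lambda>k. hdist K (F n x) (F (r k) x)) \<longlonglongrightarrow> hdist K (F n x) (f x)"
        using l[OF elim] elim x by (intro K.hdist_tendsto sq_int_carrier[OF F] fC) (auto simp: f_def)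
      then have "(\<lambda>k. ennreal ((hdist K (F n x) (F (r k) x))\<^sup>2)) \<longlonglongrightarrow> ennreal ((hdist K (F n x) (f x))\<^sup>2)"
        by (intro tendsto_ennrealI tendsto_power)
      from lim_imp_Liminf[OF _ this] show ?case by simp
    qed
    then have "(\<integral>\<^sup>+x. ennreal ((hdist K (F n x) (f x))\<^sup>2) \<partial>M) =
        (\<integral>\<^sup>+x. liminf (\<lambda>k. ennreal ((hdist K (F n x) (F (r k) x))\<^sup>2)) \<partial>M)"
      by (rule nn_integral_cong_AE)
    also have "\<dots> \<le> liminf (\<lambda>k. \<integral>\<^sup>+x. ennreal ((hdist K (F n x) (F (r k) x))\<^sup>2) \<partial>M)"
      using weakly_measurable_hdist[OF wmF wmF] by (intro nn_integral_liminf) measurable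
    also have "\<dots> \<le> ennreal (((1 / 2) ^ j)\<^sup>2)"
    proof (rule Liminf_le)
      show "\<forall>\<^sub>F k in sequentially.
          (\<integral>\<^sup>+x. ennreal ((hdist K (F n x) (F (r k) x))\<^sup>2) \<partial>M) \<le> ennreal (((1 / 2) ^ j)\<^sup>2)"
        using eventually_ge_at_top[of j]
      proof eventually_elim
        case (elim k)
        have "(hdist (L2 M K) (X n) (X (r k)))\<^sup>2 \<le> ((1 / 2) ^ j)\<^sup>2"
          using L2_hdist(1)[OF F F] N[OF n rN[OF elim]] by (intro power_mono) (auto simp: XF)
        then show ?case unfolding L2_hdist(2)[OF F F, symmetric] by (simp add: XF ennreal_leI)
      qed
    qed simp
    finally show ?thesis .
  qed
  have fsq: "f \<in> sq_int M K"
  proof (rule sq_int_of_hdist[OF F f])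
    have "(\<integral>\<^sup>+x. ennreal ((hdist K (f x) (F (N 0) x))\<^sup>2) \<partial>M) =
        (\<integral>\<^sup>+x. ennreal ((hdist K (F (N 0) x) (f x))\<^sup>2) \<partial>M)"
      by (intro nn_integral_cong) (simp add: K.hdist_commute[OF fC] sq_int_carrier[OF F])
    also have "\<dots> \<le> ennreal (((1 / 2) ^ 0)\<^sup>2)" by (rule bound) simp
    finally show "(\<integral>\<^sup>+x. ennreal ((hdist K (f x) (F (N 0) x))\<^sup>2) \<partial>M) < \<infinity>"
      by (simp add: le_less_trans)
  qed
  have "(\<lambda>n. hdist (L2 M K) (X n) (cl f)) \<longlonglongrightarrow> 0"
  proof (rule LIMSEQ_I)
    fix e :: real assume "e > 0"
    then obtain j where j: "(1 / 2 :: real) ^ j < e" using real_arch_pow_inv[of e "1 / 2"] by auto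
    have "norm (hdist (L2 M K) (X n) (cl f) - 0) < e" if "n \<ge> N j" for n
    proof -
      have "(hdist (L2 M K) (X n) (cl f))\<^sup>2 \<le> ((1 / 2) ^ j)\<^sup>2"
        using bound[OF that] unfolding L2_hdist(2)[OF F fsq, symmetric] XF by (simp add: ennreal_le_iff)
      then have "hdist (L2 M K) (X n) (cl f) \<le> (1 / 2) ^ j"
        by (rule power2_le_imp_le) simp
      then show ?thesis using j L2_hdist(1)[OF F fsq, of n] by (simp add: XF)
    qed
    then show "\<exists>N. \<forall>n\<ge>N. norm (hdist (L2 M K) (X n) (cl f) - 0) < e" by blast
  qed
  then show ?thesis using L2_carrierI[OF fsq] by blast
qed

text \<open>The algebraic laws hold pointwise for chosen square integrable functions. Definiteness
  holds almost everywhere, which is equality of classes.\<close>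

lemma L2_hilbert: "complex_hilbert_space (L2 M K)"
proof
  note ops = L2_add L2_scale L2_zero sq_int_add sq_int_scale sq_int_zero sq_int_carrier
  show "hzero (L2 M K) \<in> hcarrier (L2 M K)" by (simp add: L2_zero L2_carrierI sq_int_zero)
  show "\<exists>l\<in>hcarrier (L2 M K). (\<lambda>n. hdist (L2 M K) (X n) l) \<longlonglongrightarrow> 0"
    if "\<And>n. X n \<in> hcarrier (L2 M K)"
      "\<forall>e>0. \<exists>N. \<forall>m\<ge>N. \<forall>n\<ge>N. hdist (L2 M K) (X m) (X n) < e" for X
    using L2_complete[OF that] .
  fix X assume "X \<in> hcarrier (L2 M K)"
  then obtain \<xi> where \<xi>: "\<xi> \<in> sq_int M K" "X = cl \<xi>" by (auto simp: L2_carrier)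
  show "hscale (L2 M K) c X \<in> hcarrier (L2 M K)" for c
    using \<xi> by (simp add: ops L2_carrierI)
  show "hadd (L2 M K) X (hzero (L2 M K)) = X"
    using \<xi> by (simp add: ops) (rule cl_eqI, simp add: ops K.add_zero)
  show "hadd (L2 M K) X (hscale (L2 M K) (- 1) X) = hzero (L2 M K)"
    using \<xi> by (simp add: ops) (rule cl_eqI, simp add: ops K.add_inverse)
  show "hscale (L2 M K) (c + c') X = hadd (L2 M K) (hscale (L2 M K) c X) (hscale (L2 M K) c' X)" for c c'
    using \<xi> by (simp add: ops) (rule cl_eqI, simp add: ops K.scale_add_left)
  show "hscale (L2 M K) c (hscale (L2 M K) c' X) = hscale (L2 M K) (c * c') X" for c c'
    using \<xi> by (simp add: ops) (rule cl_eqI, simp add: ops K.scale_scale)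
  show "hscale (L2 M K) 1 X = X"
    using \<xi> by (simp add: ops) (rule cl_eqI, simp add: ops K.scale_one)
  show "0 \<le> Re (hinner (L2 M K) X X)"
    using \<xi> by (simp add: L2_inner_self)
  show "X = hzero (L2 M K)" if "hinner (L2 M K) X X = 0"
  proof -
    have "(\<integral>x. (hnorm K (\<xi> x))\<^sup>2 \<partial>M) = 0"
      using that \<xi> by (simp only: L2_inner_self of_real_eq_0_iff)
    then have "AE x in M. (hnorm K (\<xi> x))\<^sup>2 = 0"
      using \<xi> by (subst (asm) integral_nonneg_eq_0_iff_AE) (auto simp: sq_int_iff)
    then have "AE x in M. \<xi> x = hzero K"
      using AE_space by eventually_elim (use \<xi> in \<open>simp add: K.hnorm_eq_0 sq_int_carrier\<close>)
    then show ?thesis using \<xi> by (simp add: L2_zero cl_cong)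
  qed
  fix Y assume "Y \<in> hcarrier (L2 M K)"
  then obtain \<eta> where \<eta>: "\<eta> \<in> sq_int M K" "Y = cl \<eta>" by (auto simp: L2_carrier)
  show "hadd (L2 M K) X Y \<in> hcarrier (L2 M K)"
    using \<xi> \<eta> by (simp add: ops L2_carrierI)
  show "hadd (L2 M K) X Y = hadd (L2 M K) Y X"
    using \<xi> \<eta> by (simp add: ops) (rule cl_eqI, simp add: ops K.add_commute)
  show "hscale (L2 M K) c (hadd (L2 M K) X Y) = hadd (L2 M K) (hscale (L2 M K) c X) (hscale (L2 M K) c Y)" for c
    using \<xi> \<eta> by (simp add: ops) (rule cl_eqI, simp add: ops K.scale_add_right)
  show "hinner (L2 M K) X Y = cnj (hinner (L2 M K) Y X)"
  proof -
    have "(\<integral>x. hinner K (\<xi> x) (\<eta> x) \<partial>M) = (\<integral>x. cnj (hinner K (\<eta> x) (\<xi> x)) \<partial>M)"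
      using \<xi> \<eta> by (intro Bochner_Integration.integral_cong refl K.inner_commute) (auto simp: sq_int_carrier)
    then show ?thesis using \<xi> \<eta> by (simp add: L2_inner)
  qed
  show "hinner (L2 M K) X (hscale (L2 M K) c Y) = c * hinner (L2 M K) X Y" for c
  proof -
    have "(\<integral>x. hinner K (\<xi> x) (hscale K c (\<eta> x)) \<partial>M) = (\<integral>x. c * hinner K (\<xi> x) (\<eta> x) \<partial>M)"
      using \<xi> \<eta> by (intro Bochner_Integration.integral_cong refl K.inner_scale_right) (auto simp: sq_int_carrier)
    then show ?thesis using \<xi> \<eta> by (simp add: ops L2_inner)
  qed
  fix Z assume "Z \<in> hcarrier (L2 M K)"
  then obtain \<zeta> where \<zeta>: "\<zeta> \<in> sq_int M K" "Z = cl \<zeta>" by (auto simp: L2_carrier)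
  show "hadd (L2 M K) (hadd (L2 M K) X Y) Z = hadd (L2 M K) X (hadd (L2 M K) Y Z)"
    using \<xi> \<eta> \<zeta> by (simp add: ops) (rule cl_eqI, simp add: ops K.add_assoc)
  show "hinner (L2 M K) X (hadd (L2 M K) Y Z) = hinner (L2 M K) X Y + hinner (L2 M K) X Z"
  proof -
    have "(\<integral>x. hinner K (\<xi> x) (hadd K (\<eta> x) (\<zeta> x)) \<partial>M) = (\<integral>x. hinner K (\<xi> x) (\<eta> x) + hinner K (\<xi> x) (\<zeta> x) \<partial>M)"
      using \<xi> \<eta> \<zeta> by (intro Bochner_Integration.integral_cong refl K.inner_add_right) (auto simp: sq_int_carrier)
    then show ?thesis using \<xi> \<eta> \<zeta> by (simp add: ops L2_inner sq_int_inner_integrable)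
  qed
qed

end

section \<open>Positive functionals on C*-algebras\<close>

text \<open>The C*-identity and submultiplicativity give one inequality; applied to
  \<open>adj x\<close> it becomes the other.\<close>

lemma norm_adj: "norm (adj x) = norm (x :: 'a::cstar_algebra)"
proof -
  have le: "norm y \<le> norm (adj y)" for y :: 'a
  proof (cases "norm y = 0")
    case False
    have "norm y * norm y \<le> norm (adj y) * norm y"
      using norm_mult_ineq[of "adj y" y] by (simp add: cstar_identity power2_eq_square)
    then show ?thesis using False by simp
  qed simp
  from le[of x] le[of "adj x"] show ?thesis by (simp add: adj_adj)
qed

lemma bounded_linear_adj: "bounded_linear (adj :: 'a::cstar_algebra \<Rightarrow> 'a)"
proof (rule bounded_linear_intro)
  show "adj (r *\<^sub>R x) = r *\<^sub>R adj x" for r and x :: 'a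
    by (metis adj_scaleC complex_cnj_complex_of_real scaleC_of_real)
  show "norm (adj x) \<le> norm x * 1" for x :: 'a by (simp add: norm_adj)
qed (simp add: adj_add)

lemma bounded_linear_scaleC: "bounded_linear (scaleC c :: 'a::cstar_algebra \<Rightarrow> 'a)"
proof (rule bounded_linear_intro)
  show "scaleC c (r *\<^sub>R x) = r *\<^sub>R scaleC c x" for r and x :: 'a
    by (simp add: scaleC_scaleC mult.commute flip: scaleC_of_real)
  show "norm (scaleC c x) \<le> norm x * cmod c" for x :: 'a by (simp add: norm_scaleC)
qed (simp add: scaleC_add_right)

lemma adj_one [simp]: "adj (1 :: 'a::cstar_algebra) = 1"
  by (metis adj_adj adj_mult mult.left_neutral mult.right_neutral)

lemma adj_power: "adj (x ^ n) = adj x ^ n" for x :: "'a::cstar_algebra"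
  by (induction n) (simp_all add: adj_mult power_commutes)

text \<open>Consecutive coefficients have a ratio of absolute value |1/2 - n| / (n + 1), which is at
  most 1. The bound lets a geometric series dominate the square root series.\<close>

lemma abs_gbinomial_half_le_one: "\<bar>(1 / 2 :: real) gchoose n\<bar> \<le> 1"
proof (induction n)
  case (Suc n)
  have "(1 / 2 - real n) * ((1 / 2) gchoose n) = real (Suc n) * ((1 / 2) gchoose Suc n)"
    using gbinomial_mult_1[of "1 / 2 :: real" n] by (simp add: algebra_simps)
  then have "real (Suc n) * \<bar>(1 / 2 :: real) gchoose Suc n\<bar> = \<bar>1 / 2 - real n\<bar> * \<bar>(1 / 2) gchoose n\<bar>"
    by (metis abs_mult abs_of_nat)
  also have "\<dots> \<le> real (Suc n) * 1"
    using Suc by (intro mult_mono) auto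
  finally show ?case by (simp only: mult_le_cancel_left_pos of_nat_0_less_iff zero_less_Suc)
qed simp

text \<open>The square root is the binomial series of \<open>(1 - b)\<^sup>1\<^sup>/\<^sup>2\<close>; it squares to \<open>1 - b\<close> by
  Vandermonde's identity.\<close>

lemma one_minus_selfadjoint_is_square:
  fixes b :: "'a::cstar_algebra"
  assumes "adj b = b" "norm b < 1"
  obtains c where "adj c = c" "c * c = 1 - b"
proof -
  define f where "f n = ((1 / 2 :: real) gchoose n) *\<^sub>R (- b) ^ n" for n
  have sum: "summable (\<lambda>n. norm (f n))"
  proof (rule summable_comparison_test')
    show "summable (\<lambda>n. norm b ^ n)" using assms by (intro summable_geometric) simp
    show "norm (norm (f n)) \<le> norm b ^ n" for n
    proof -
      have "norm (f n) \<le> 1 * norm (- b) ^ n"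
        unfolding f_def norm_scaleR using abs_gbinomial_half_le_one
        by (intro mult_mono norm_power_ineq) auto
      then show ?thesis by simp
    qed
  qed
  define c where "c = (\<Sum>n. f n)"
  have "adj (f n) = f n" for n
    using assms(1) unfolding f_def
    by (simp add: bounded_linear.linear[OF bounded_linear_adj, THEN linear_scale] adj_power
        bounded_linear.linear[OF bounded_linear_adj, THEN linear_neg])
  then have "adj c = c"
    unfolding c_def using bounded_linear.suminf[OF bounded_linear_adj summable_norm_cancel[OF sum]]
    by simp
  moreover have "c * c = 1 - b"
  proof -
    have "(\<Sum>i\<le>k. f i * f (k - i)) = ((1 :: real) gchoose k) *\<^sub>R (- b) ^ k" for k
    proof -
      have "(\<Sum>i\<le>k. f i * f (k - i)) =
          (\<Sum>i\<le>k. ((1 / 2 :: real) gchoose i) * ((1 / 2) gchoose (k - i))) *\<^sub>R (- b) ^ k"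
        unfolding scaleR_sum_left f_def
        by (intro sum.cong refl) (simp flip: power_add)
      then show ?thesis using gbinomial_Vandermonde[of "1 / 2 :: real" "1 / 2" k] by (simp add: atLeast0AtMost)
    qed
    then have "(\<lambda>k. ((1 :: real) gchoose k) *\<^sub>R (- b) ^ k) sums (c * c)"
      using Cauchy_product_sums[OF sum sum] by (simp add: c_def)
    \<comment> \<open>The upper index is 1/2 + 1/2 = 1, so the product series stops after k =
      1.\<close>
    moreover have "(\<lambda>k. ((1 :: real) gchoose k) *\<^sub>R (- b) ^ k) sums
        (\<Sum>k\<in>{0,1}. ((1 :: real) gchoose k) *\<^sub>R (- b) ^ k)"
    proof (rule sums_finite)
      fix k :: nat assume "k \<notin> {0, 1}"
      then have "(1 choose k) = (0 :: nat)" by (intro binomial_eq_0) auto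
      then have "((1 :: real) gchoose k) = 0" by (metis binomial_gbinomial of_nat_0 of_nat_1)
      then show "((1 :: real) gchoose k) *\<^sub>R (- b) ^ k = 0" by simp
    qed simp
    ultimately show ?thesis using sums_unique2 by fastforce
  qed
  ultimately show ?thesis using that by blast
qed

text \<open>A state without its normalization: the functionals of arbitrary vectors are also needed,
  and their value at 1 is the squared norm of the vector.\<close>

definition positive_functional :: "('a::cstar_algebra \<Rightarrow> complex) \<Rightarrow> bool" where
  "positive_functional \<phi> \<longleftrightarrow>
     (\<forall>x y. \<phi> (x + y) = \<phi> x + \<phi> y) \<and> (\<forall>c x. \<phi> (scaleC c x) = c * \<phi> x) \<and>
     (\<forall>x. Im (\<phi> (adj x * x)) = 0 \<and> 0 \<le> Re (\<phi> (adj x * x)))"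

lemma positive_functional_scaleR:
  "positive_functional \<phi> \<Longrightarrow> \<phi> (r *\<^sub>R x) = complex_of_real r * \<phi> x"
  by (metis positive_functional_def scaleC_of_real)

lemma positive_functional_diff:
  assumes "positive_functional \<phi>"
  shows "\<phi> (x - y) = \<phi> x - \<phi> y"
proof -
  have "\<phi> x = \<phi> ((x - y) + y)" by simp
  also have "\<dots> = \<phi> (x - y) + \<phi> y" using assms unfolding positive_functional_def by blast
  finally show ?thesis by simp
qed

text \<open>For t > norm h the element 1 - h/t is the square of a self-adjoint element, so \<phi> 1
  - \<phi> h / t is real and nonnegative. The bound follows as t decreases to the norm of h.\<close>

lemma positive_functional_selfadjoint:
  assumes \<phi>: "positive_functional \<phi>" and h: "adj h = h"
  shows "Im (\<phi> h) = 0" and "Re (\<phi> h) \<le> norm h * Re (\<phi> 1)"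
proof -
  have pos: "Im (\<phi> (adj x * x)) = 0" "0 \<le> Re (\<phi> (adj x * x))" for x
    using \<phi> by (simp_all add: positive_functional_def)
  have one: "Im (\<phi> 1) = 0" "0 \<le> Re (\<phi> 1)" using pos[of 1] by simp_all
  have *: "Im (\<phi> h) = 0 \<and> Re (\<phi> h) \<le> t * Re (\<phi> 1)" if t: "t > norm h" for t
  proof -
    have t0: "t > 0" using t norm_ge_zero[of h] by linarith
    have "adj ((1 / t) *\<^sub>R h) = (1 / t) *\<^sub>R h"
      using h by (simp add: bounded_linear.linear[OF bounded_linear_adj, THEN linear_scale])
    moreover have "norm ((1 / t) *\<^sub>R h) < 1" using t t0 by simp
    ultimately obtain c where c: "adj c = c" "c * c = 1 - (1 / t) *\<^sub>R h"
      using one_minus_selfadjoint_is_square by blast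
    have "\<phi> (adj c * c) = \<phi> 1 - complex_of_real (1 / t) * \<phi> h"
      using \<phi> c by (simp only: positive_functional_diff positive_functional_scaleR)
    then have "Im (\<phi> (adj c * c)) = Im (\<phi> 1) - Im (\<phi> h) / t"
      "Re (\<phi> (adj c * c)) = Re (\<phi> 1) - Re (\<phi> h) / t"
      by simp_all
    then show ?thesis
      using pos[of c] one t0 by (simp add: pos_divide_le_eq mult.commute)
  qed
  show "Im (\<phi> h) = 0" using *[of "norm h + 1"] by simp
  show "Re (\<phi> h) \<le> norm h * Re (\<phi> 1)"
  \<comment> \<open>The passage to the limit in t is made after dividing by Re (\<phi> 1), so the
    value 0 is treated apart.\<close>
  proof (cases "Re (\<phi> 1) = 0")
    case True
    then show ?thesis using *[of "norm h + 1"] by simp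
  next
    case False
    then have "Re (\<phi> 1) > 0" using one by simp
    then have "Re (\<phi> h) / Re (\<phi> 1) \<le> t" if "norm h < t" for t
      using *[OF that] by (simp add: pos_divide_le_eq)
    then have "Re (\<phi> h) / Re (\<phi> 1) \<le> norm h" by (rule dense_ge)
    then show ?thesis using \<open>Re (\<phi> 1) > 0\<close> by (simp add: pos_divide_le_eq)
  qed
qed

text \<open>By the C*-identity the self-adjoint element \<open>adj a * a\<close> has norm
  \<open>(norm a)\<^sup>2\<close>. For vector functionals the bound becomes contractivity of the
  representation.\<close>

lemma positive_functional_adj_mult_le:
  assumes "positive_functional \<phi>"
  shows "Re (\<phi> (adj a * a)) \<le> (norm a)\<^sup>2 * Re (\<phi> 1)"
  using positive_functional_selfadjoint(2)[OF assms, of "adj a * a"]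
  by (simp add: adj_mult adj_adj cstar_identity)

lemma positive_functional_bounded_linear:
  assumes \<phi>: "positive_functional \<phi>"
  shows "bounded_linear \<phi>"
proof (rule bounded_linear_intro)
  show "\<phi> (x + y) = \<phi> x + \<phi> y" for x y using \<phi> by (simp add: positive_functional_def)
  show "\<phi> (r *\<^sub>R x) = r *\<^sub>R \<phi> x" for r x
    using \<phi> by (simp only: positive_functional_scaleR scaleR_conv_of_real[of r "\<phi> x"])
  have neg: "\<phi> (- x) = - \<phi> x" for x using positive_functional_scaleR[OF \<phi>, of "-1" x] by simp
  have sa: "cmod (\<phi> h) \<le> norm h * Re (\<phi> 1)" if "adj h = h" for h
  proof -
    have "adj (- h) = - h"
      using that by (simp add: bounded_linear.linear[OF bounded_linear_adj, THEN linear_neg])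
    then show ?thesis
      using positive_functional_selfadjoint[OF \<phi> that] positive_functional_selfadjoint[OF \<phi>, of "- h"]
      by (simp add: neg cmod_eq_Re)
  qed
  show "cmod (\<phi> x) \<le> norm x * (2 * Re (\<phi> 1))" for x
  proof -
    \<comment> \<open>The decomposition x = h + i k into self-adjoint parts, each of norm at most
      \<open>norm x\<close>; the two parts account for the factor 2 in the bound.\<close>
    define h where "h = (1 / 2 :: real) *\<^sub>R (x + adj x)"
    define k where "k = scaleC (- \<i>) ((1 / 2 :: real) *\<^sub>R (x - adj x))"
    have adjR: "adj (r *\<^sub>R y) = r *\<^sub>R adj y" "adj (y - z) = adj y - adj z" for r and y z :: 'a
      by (simp_all add: bounded_linear.linear[OF bounded_linear_adj, THEN linear_scale]
          bounded_linear.linear[OF bounded_linear_adj, THEN linear_diff])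
    have "adj h = h" by (simp add: h_def adjR adj_add adj_adj add.commute)
    have "adj k = scaleC \<i> ((1 / 2 :: real) *\<^sub>R (adj x - x))"
      by (simp add: k_def adj_scaleC adjR adj_adj)
    also have "\<dots> = scaleC \<i> (scaleC (-1) ((1 / 2 :: real) *\<^sub>R (x - adj x)))"
    proof -
      have "scaleC (-1) y = - y" for y :: 'a using scaleC_of_real[of "-1" y] by simp
      then show ?thesis by (simp flip: scaleR_minus_right)
    qed
    finally have "adj k = k" by (simp add: scaleC_scaleC k_def)
    have "scaleC \<i> k = (1 / 2 :: real) *\<^sub>R (x - adj x)"
      using scaleC_of_real[of 1] by (simp add: k_def scaleC_scaleC)
    then have x: "x = h + scaleC \<i> k"
      by (simp add: h_def scaleR_right_diff_distrib scaleR_right_distrib flip: scaleR_add_left)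
    have "norm h \<le> norm x" "norm k \<le> norm x"
      using norm_triangle_ineq[of x "adj x"] norm_triangle_ineq4[of x "adj x"]
      by (simp_all add: h_def k_def norm_scaleC norm_adj)
    have R: "0 \<le> Re (\<phi> 1)" using \<phi> by (metis adj_one mult_1 positive_functional_def)
    have "\<phi> x = \<phi> h + \<i> * \<phi> k" using \<phi> by (subst x) (simp add: positive_functional_def)
    then have "cmod (\<phi> x) \<le> cmod (\<phi> h) + cmod (\<phi> k)"
      using norm_triangle_ineq[of "\<phi> h" "\<i> * \<phi> k"] by (simp add: norm_mult)
    also have "\<dots> \<le> norm h * Re (\<phi> 1) + norm k * Re (\<phi> 1)"
      using sa \<open>adj h = h\<close> \<open>adj k = k\<close> by (intro add_mono) auto
    also have "\<dots> \<le> norm x * Re (\<phi> 1) + norm x * Re (\<phi> 1)"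
      using R \<open>norm h \<le> norm x\<close> \<open>norm k \<le> norm x\<close> by (intro add_mono mult_right_mono) auto
    finally show ?thesis by simp
  qed
qed

section \<open>The words \<open>s\<^sub>\<alpha> s\<^sub>\<gamma>\<^sup>*\<close> span a dense subspace\<close>

lemma multi_prod_simps [simp]:
  "multi_prod s [] = 1" "multi_prod s (i # \<alpha>) = s i * multi_prod s \<alpha>"
  "multi_prod s (\<alpha> @ \<beta>) = multi_prod s \<alpha> * multi_prod s \<beta>"
  by (simp_all add: multi_prod_def)

text \<open>Scalars act through \<open>scaleC\<close>, and the inductive form turns stability under
  products and adjoints into rule inductions.\<close>

inductive_set complex_span :: "'a::cstar_algebra set \<Rightarrow> 'a set" for S where
  base: "x \<in> S \<Longrightarrow> x \<in> complex_span S"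
| zero: "0 \<in> complex_span S"
| add: "\<lbrakk>x \<in> complex_span S; y \<in> complex_span S\<rbrakk> \<Longrightarrow> x + y \<in> complex_span S"
| scale: "x \<in> complex_span S \<Longrightarrow> scaleC c x \<in> complex_span S"

lemma complex_span_mult:
  assumes S: "\<And>x y. x \<in> S \<Longrightarrow> y \<in> S \<Longrightarrow> x * y \<in> complex_span S"
    and x: "x \<in> complex_span S" and y: "y \<in> complex_span S"
  shows "x * y \<in> complex_span S"
  using x
proof induction
  case (base x)
  from y show ?case
    by induction (auto simp: distrib_left scaleC_mult_right intro: complex_span.intros S base)
qed (auto simp: distrib_right scaleC_mult_left intro: complex_span.intros)

text \<open>All operations are continuous, so stability passes from the span to its closure along
  sequences. Products of generators are asked to lie in the span rather than in \<open>S\<close>,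
  since a product of two Cuntz words may be 0.\<close>

lemma cstar_subalgebra_closure_complex_span:
  assumes "1 \<in> S" and mult: "\<And>x y. x \<in> S \<Longrightarrow> y \<in> S \<Longrightarrow> x * y \<in> complex_span S"
    and adj: "\<And>x. x \<in> S \<Longrightarrow> adj x \<in> S"
  shows "cstar_subalgebra (closure (complex_span S))"
  unfolding cstar_subalgebra_def
proof (intro conjI ballI allI)
  show "1 \<in> closure (complex_span S)"
    using assms(1) closure_subset complex_span.base by blast
  have adj_span: "adj x \<in> complex_span S" if "x \<in> complex_span S" for x
    using that
    by induction (auto simp: adj_add adj_scaleC linear_0[OF bounded_linear.linear[OF bounded_linear_adj]]
        intro: complex_span.intros adj)
  fix x assume "x \<in> closure (complex_span S)"
  then obtain X where X: "\<And>n. X n \<in> complex_span S" "X \<longlonglongrightarrow> x"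
    by (auto simp: closure_sequential)
  show "adj x \<in> closure (complex_span S)"
    using X adj_span bounded_linear.tendsto[OF bounded_linear_adj X(2)]
    unfolding closure_sequential by (intro exI[of _ "\<lambda>n. adj (X n)"]) auto
  show "scaleC c x \<in> closure (complex_span S)" for c
    using X complex_span.scale[OF X(1)] bounded_linear.tendsto[OF bounded_linear_scaleC X(2)]
    unfolding closure_sequential by (intro exI[of _ "\<lambda>n. scaleC c (X n)"]) auto
  fix y assume "y \<in> closure (complex_span S)"
  then obtain Y where Y: "\<And>n. Y n \<in> complex_span S" "Y \<longlonglongrightarrow> y"
    by (auto simp: closure_sequential)
  show "x + y \<in> closure (complex_span S)"
    using X Y complex_span.add[OF X(1) Y(1)] tendsto_add[OF X(2) Y(2)]
    unfolding closure_sequential by (intro exI[of _ "\<lambda>n. X n + Y n"]) auto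
  show "x * y \<in> closure (complex_span S)"
    using complex_span_mult[OF mult X(1) Y(1)] tendsto_mult[OF X(2) Y(2)]
    unfolding closure_sequential by (intro exI[of _ "\<lambda>n. X n * Y n"]) auto
qed simp

definition cuntz_words :: "nat \<Rightarrow> (nat \<Rightarrow> 'a::cstar_algebra) \<Rightarrow> 'a set" where
  "cuntz_words d s = {multi_prod s \<alpha> * adj (multi_prod s \<gamma>) | \<alpha> \<gamma>. \<alpha> \<in> lists {1..d} \<and> \<gamma> \<in> lists {1..d}}"

lemma cuntz_wordsI:
  "\<lbrakk>\<alpha> \<in> lists {1..d}; \<gamma> \<in> lists {1..d}\<rbrakk> \<Longrightarrow>
    multi_prod s \<alpha> * adj (multi_prod s \<gamma>) \<in> cuntz_words d s"
  unfolding cuntz_words_def by blast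

text \<open>The innermost pair \<open>adj (s i) * s j\<close> is 1 or 0. Cancellation continues
  until two letters differ or one word is used up; what is left of the other one is a word or the
  adjoint of a word.\<close>

lemma cuntz_adj_mult:
  assumes s: "cuntz_generators d s" and "\<beta> \<in> lists {1..d}" "\<gamma> \<in> lists {1..d}"
  shows "adj (multi_prod s \<gamma>) * multi_prod s \<beta> = 0 \<or>
    (\<exists>\<alpha>\<in>lists {1..d}. adj (multi_prod s \<gamma>) * multi_prod s \<beta> = multi_prod s \<alpha> \<or>
       adj (multi_prod s \<gamma>) * multi_prod s \<beta> = adj (multi_prod s \<alpha>))"
  using assms(2,3)
proof (induction \<gamma> arbitrary: \<beta>)
  case Nil
  then show ?case by auto
next
  case (Cons i \<gamma>)
  show ?case
  proof (cases \<beta>)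
    case Nil
    then show ?thesis using Cons.prems by (intro disjI2 bexI[of _ "i # \<gamma>"]) auto
  next
    case (Cons j \<beta>')
    have "adj (multi_prod s (i # \<gamma>)) * multi_prod s \<beta> =
        adj (multi_prod s \<gamma>) * (adj (s i) * s j) * multi_prod s \<beta>'"
      by (simp add: Cons adj_mult mult.assoc)
    also have "adj (s i) * s j = (if i = j then 1 else 0)"
      using s Cons Cons.prems unfolding cuntz_generators_def by simp
    finally show ?thesis
      using Cons.IH[of \<beta>'] Cons Cons.prems by (cases "i = j") simp_all
  qed
qed

lemma cuntz_words_dense:
  assumes s: "cuntz_generators d s"
  shows "closure (complex_span (cuntz_words d s)) = UNIV"
proof -
  have "cstar_subalgebra (closure (complex_span (cuntz_words d s)))"
  proof (rule cstar_subalgebra_closure_complex_span)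
    show "1 \<in> cuntz_words d s"
      unfolding cuntz_words_def by (intro CollectI exI[of _ "[]"]) simp
    show "adj x \<in> cuntz_words d s" if "x \<in> cuntz_words d s" for x
      using that unfolding cuntz_words_def by (force simp: adj_mult adj_adj simp del: One_nat_def)
    fix x y assume "x \<in> cuntz_words d s" "y \<in> cuntz_words d s"
    then obtain \<alpha> \<gamma> \<beta> \<delta> where w: "\<alpha> \<in> lists {1..d}" "\<gamma> \<in> lists {1..d}" "\<beta> \<in> lists {1..d}" "\<delta> \<in> lists {1..d}"
      and xy: "x = multi_prod s \<alpha> * adj (multi_prod s \<gamma>)" "y = multi_prod s \<beta> * adj (multi_prod s \<delta>)"
      unfolding cuntz_words_def by blast
    have eq: "x * y = multi_prod s \<alpha> * (adj (multi_prod s \<gamma>) * multi_prod s \<beta>) * adj (multi_prod s \<delta>)"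
      by (simp add: xy mult.assoc)
    consider (zero) "adj (multi_prod s \<gamma>) * multi_prod s \<beta> = 0"
      | (left) \<epsilon> where "\<epsilon> \<in> lists {1..d}" "adj (multi_prod s \<gamma>) * multi_prod s \<beta> = multi_prod s \<epsilon>"
      | (right) \<epsilon> where "\<epsilon> \<in> lists {1..d}" "adj (multi_prod s \<gamma>) * multi_prod s \<beta> = adj (multi_prod s \<epsilon>)"
      using cuntz_adj_mult[OF s w(3,2)] by blast
    then show "x * y \<in> complex_span (cuntz_words d s)"
    proof cases
      case zero
      then show ?thesis by (simp add: eq complex_span.zero)
    next
      case left
      then have "x * y = multi_prod s (\<alpha> @ \<epsilon>) * adj (multi_prod s \<delta>)" by (simp add: eq)
      then show ?thesis using left w cuntz_wordsI[of "\<alpha> @ \<epsilon>" d \<delta> s]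
        by (auto intro: complex_span.base)
    next
      case right
      then have "x * y = multi_prod s \<alpha> * adj (multi_prod s (\<delta> @ \<epsilon>))"
        by (simp add: eq adj_mult mult.assoc)
      then show ?thesis using right w cuntz_wordsI[of \<alpha> d "\<delta> @ \<epsilon>" s]
        by (auto intro: complex_span.base)
    qed
  qed
  moreover have "s ` {1..d} \<subseteq> closure (complex_span (cuntz_words d s))"
  proof (clarify)
    fix i assume "i \<in> {1..d}"
    then have "s i \<in> cuntz_words d s"
      unfolding cuntz_words_def by (intro CollectI exI[of _ "[i]"] exI[of _ "[]"]) auto
    then show "s i \<in> closure (complex_span (cuntz_words d s))"
      using closure_subset complex_span.base by blast
  qed
  ultimately show ?thesis using s unfolding cuntz_generators_def by blast
qed

text \<open>Density packaged as an induction rule. It is applied to the set where two functionals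
  agree, and to the set of elements that send the cyclic vector into a given closed
  subspace.\<close>

lemma cuntz_words_induct:
  assumes s: "cuntz_generators d s" and "closed P" "0 \<in> P"
    and "\<And>x y. x \<in> P \<Longrightarrow> y \<in> P \<Longrightarrow> x + y \<in> P" "\<And>c x. x \<in> P \<Longrightarrow> scaleC c x \<in> P"
    and "\<And>\<alpha> \<gamma>. \<alpha> \<in> lists {1..d} \<Longrightarrow> \<gamma> \<in> lists {1..d} \<Longrightarrow> multi_prod s \<alpha> * adj (multi_prod s \<gamma>) \<in> P"
  shows "a \<in> P"
proof -
  have "x \<in> P" if "x \<in> complex_span (cuntz_words d s)" for x
    using that
  proof induction
    case (base x)
    then show ?case using assms(6) unfolding cuntz_words_def by blast
  qed (use assms in auto)
  then have "closure (complex_span (cuntz_words d s)) \<subseteq> P"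
    using \<open>closed P\<close> by (intro closure_minimal) auto
  then show ?thesis using cuntz_words_dense[OF s] by auto
qed

section \<open>Shift and constant vectors on the Bernoulli space\<close>

text \<open>With \<open>One_nat_def\<close>, simp would rewrite the index set \<open>{1..d}\<close>.\<close>

declare One_nat_def [simp del] ell2_sel [simp del]

lemma left_reg_ket:
  assumes "group G" "g \<in> carrier G" "h \<in> carrier G"
  shows "left_reg G g (ket h) = ket (g \<otimes>\<^bsub>G\<^esub> h)"
proof
  fix x
  interpret group G by fact
  show "left_reg G g (ket h) x = ket (g \<otimes>\<^bsub>G\<^esub> h) x"
  proof (cases "x \<in> carrier G")
    case True
    have "inv\<^bsub>G\<^esub> g \<otimes>\<^bsub>G\<^esub> x = h \<longleftrightarrow> x = g \<otimes>\<^bsub>G\<^esub> h"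
      using assms True inv_solve_left'[of h g x] by auto
    then show ?thesis using True by (simp add: left_reg_def ket_def)
  next
    case False
    then have "x \<noteq> g \<otimes>\<^bsub>G\<^esub> h" using assms by auto
    then show ?thesis using False by (simp add: left_reg_def ket_def)
  qed
qed

lemma gen_carrier: "i \<in> {1..d} \<Longrightarrow> gen i \<in> carrier (Fd d)"
  by (simp add: gen_def free_group_def)

lemma gword_Nil: "gword d [] = \<one>\<^bsub>Fd d\<^esub>"
  by (simp add: gword_def)

lemma gword_Cons: "gword d (i # \<alpha>) = gen i \<otimes>\<^bsub>Fd d\<^esub> gword d \<alpha>"
  by (simp add: gword_def)

lemma gword_carrier:
  assumes "\<alpha> \<in> lists {1..d}"
  shows "gword d \<alpha> \<in> carrier (Fd d)"
proof -
  interpret group "Fd d" by (rule group_free_group)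
  show ?thesis using assms
    by induction (simp_all add: gword_Nil gword_Cons gen_carrier)
qed

text \<open>A product of positive generators never meets an inverse letter, so no reduction takes
  place.\<close>

lemma gword_eq_map: "gword d \<alpha> = map (\<lambda>i. (i, True)) \<alpha>"
proof (induction \<alpha>)
  case (Cons i \<alpha>)
  then show ?case by (cases \<alpha>) (simp_all add: gword_Cons gen_def free_group_def)
qed (simp add: gword_Nil free_group_def)

text \<open>Freeness of the semigroup, the source of the Kronecker delta in
  \<open>vector_state_word\<close>.\<close>

lemma inj_gword: "gword d \<alpha> = gword d \<beta> \<longleftrightarrow> \<alpha> = \<beta>"
  by (simp add: gword_eq_map inj_map_eq_map inj_on_def)

section \<open>The product measure, its shift and constant functions\<close>

locale bernoulli_space =
  fixes d :: nat and p :: "nat \<Rightarrow> real"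
  assumes p_pos: "\<And>i. i \<in> {1..d} \<Longrightarrow> 0 < p i" and p_sum: "(\<Sum>i=1..d. p i) = 1"
begin

abbreviation M where "M \<equiv> prod_measure d p"
abbreviation K where "K \<equiv> ell2 (carrier (Fd d))"
abbreviation H where "H \<equiv> big_space d p"

sublocale G: group "Fd d" by (rule group_free_group)

lemma prob_space_point: "prob_space (point_measure {1..d} (\<lambda>i. ennreal (p i)))"
proof (rule prob_spaceI)
  have "(\<Sum>i\<in>{1..d}. ennreal (p i)) = ennreal (\<Sum>i\<in>{1..d}. p i)"
    using p_pos by (intro sum_ennreal) (auto intro: less_imp_le)
  then show "emeasure (point_measure {1..d} (\<lambda>i. ennreal (p i))) (space (point_measure {1..d} (\<lambda>i. ennreal (p i)))) = 1"
    by (simp add: space_point_measure emeasure_point_measure_finite p_sum)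
qed

sublocale prob_space M
  unfolding prod_measure_def by (intro prob_space_PiM prob_space_point)

sublocale L2_space M K
proof (rule L2_space.intro)
  show "complex_hilbert_space K" by (rule ell2_hilbert)
qed (rule ell2_inner_measurable[OF countableI_type])

lemma big_space_eq: "H = L2 M K"
  by (simp add: big_space_def)

sublocale big: complex_hilbert_space H
  unfolding big_space_eq by (rule L2_hilbert)

lemma first_letter_measurable: "{x \<in> space M. x 0 = i} \<in> sets M"
proof (cases "i \<in> {1..d}")
  case True
  have "(\<lambda>x. x 0) \<in> measurable M (point_measure {1..d} (\<lambda>i. ennreal (p i)))"
    unfolding prod_measure_def by (rule measurable_component_singleton) simp
  then have "(\<lambda>x. x 0) -` {i} \<inter> space M \<in> sets M"
    by (rule measurable_sets) (use True in \<open>simp add: sets_point_measure\<close>)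
  moreover have "(\<lambda>x. x 0) -` {i} \<inter> space M = {x \<in> space M. x 0 = i}" by auto
  ultimately show ?thesis by simp
next
  case False
  then have "{x \<in> space M. x 0 = i} = {}"
    unfolding prod_measure_def space_PiM space_point_measure by (auto)
  then show ?thesis by (simp only: sets.empty_sets)
qed

text \<open>Dropping the first coordinate is reindexing along the injection \<open>Suc\<close>,
  which preserves a product of identical probability measures. This controls the representative that
  \<open>T_op\<close> composes with the shift.\<close>

lemma AE_shift:
  assumes "AE x in M. P x"
  shows "AE x in M. P (shift x)"
proof -
  have sh: "(\<lambda>x. \<lambda>n\<in>UNIV. x (Suc n)) = shift" by (auto simp: shift_def fun_eq_iff)
  have "distr M M shift = M"
    using distr_PiM_reindex[of UNIV "\<lambda>_. point_measure {1..d} (\<lambda>i. ennreal (p i))" Suc UNIV]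
      prob_space_point unfolding sh by (simp add: prod_measure_def)
  moreover have "shift \<in> measurable M M"
    unfolding prod_measure_def
  proof (rule measurable_PiM_single')
    fix n
    show "(\<lambda>x. shift x n) \<in> measurable (PiM UNIV (\<lambda>_. point_measure {1..d} (\<lambda>i. ennreal (p i))))
        (point_measure {1..d} (\<lambda>i. ennreal (p i)))"
      unfolding shift_def by (rule measurable_component_singleton) simp
  qed (auto simp: space_PiM shift_def)
  ultimately show ?thesis using AE_distrD[of shift M M P] assms by (simp only:)
qed

text \<open>The vector 1 \<otimes> k; for the basis vector at the neutral element it is the cyclic
  vector.\<close>

definition const :: "(nat fword \<Rightarrow> complex) \<Rightarrow> vec" where
  "const k = cl (\<lambda>x. k)"

lemma const_sq_int: "k \<in> hcarrier K \<Longrightarrow> (\<lambda>x. k) \<in> sq_int M K"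
  by (simp add: sq_int_iff weakly_measurable_const)

lemma const_if_sq_int:
  assumes k: "k \<in> hcarrier K" and A: "A \<in> sets M"
  shows "(\<lambda>x. if x \<in> A then k else hzero K) \<in> sq_int M K"
proof -
  have "integrable M (\<lambda>x. indicator A x * (hnorm K k)\<^sup>2)"
    using A by (intro integrable_mult_left integrable_real_indicator) (simp_all add: emeasure_finite less_top[symmetric])
  moreover have "indicator A x * (hnorm K k)\<^sup>2 = (hnorm K (if x \<in> A then k else hzero K))\<^sup>2" for x
    by (simp add: K.hnorm_zero)
  ultimately have "integrable M (\<lambda>x. (hnorm K (if x \<in> A then k else hzero K))\<^sup>2)" by simp
  then show ?thesis
    using weakly_measurable_if[OF weakly_measurable_const[OF k] A] unfolding sq_int_iff by blast
qed

lemma const_carrier: "k \<in> hcarrier K \<Longrightarrow> const k \<in> hcarrier H"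
  by (simp add: const_def big_space_eq L2_carrierI const_sq_int)

lemma const_inner:
  "\<lbrakk>k \<in> hcarrier K; l \<in> hcarrier K\<rbrakk> \<Longrightarrow> hinner H (const k) (const l) = hinner K k l"
  by (simp add: const_def big_space_eq L2_inner const_sq_int prob_space)

lemma const_isometry: "hisometry K H const"
  unfolding hisometry_def hlinear_def
proof (intro conjI ballI allI)
  fix k assume k: "k \<in> hcarrier K"
  show "const (hscale K c k) = hscale H c (const k)" for c
    unfolding const_def big_space_eq L2_scale[OF const_sq_int[OF k]] ..
  show "hnorm H (const k) = hnorm K k"
    using k by (simp add: hnorm_def const_inner)
  show "const (hadd K k l) = hadd H (const k) (const l)" if l: "l \<in> hcarrier K" for l
    unfolding const_def big_space_eq L2_add[OF const_sq_int[OF k] const_sq_int[OF l]] ..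
qed (rule const_carrier)

text \<open>The representative chosen by \<open>T_op\<close> equals \<open>k\<close> almost
  everywhere, and by \<open>AE_shift\<close> it still does after composition with the shift.\<close>

lemma T_op_const:
  "T_op d p i (const k) = cl (\<lambda>x g. of_real (p i powr (-1/2)) * (if x 0 = i then 1 else 0) *
       left_reg (Fd d) (gen i) k g)" if "k \<in> hcarrier K"
proof -
  have "AE x in M. rep (const k) x = k"
    unfolding const_def using that by (intro rep_cl const_sq_int)
  then have "AE x in M. rep (const k) (shift x) = k" by (rule AE_shift)
  then show ?thesis unfolding T_op_def by (rule cl_cong[OF eventually_mono]) simp
qed

text \<open>All members of the class T_i Y vanish almost everywhere off x_1 = i. That the class lies
  in the carrier guarantees that it has a member.\<close>

lemma T_op_orthogonal:
  assumes "T_op d p i Y \<in> hcarrier H" and \<xi>: "\<xi> \<in> sq_int M K"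
    and supp: "\<And>x. x \<in> space M \<Longrightarrow> x 0 = i \<Longrightarrow> \<xi> x = hzero K"
  shows "hinner H (cl \<xi>) (T_op d p i Y) = 0"
proof -
  obtain \<eta> where \<eta>: "\<eta> \<in> sq_int M K" "T_op d p i Y = cl \<eta>"
    using assms(1) by (auto simp: big_space_eq L2_carrier)
  then have "\<eta> \<in> T_op d p i Y" using self_in_cl by simp
  then have "AE x in M. \<eta> x = (\<lambda>g. of_real (p i powr (-1/2)) * (if x 0 = i then 1 else 0) *
       left_reg (Fd d) (gen i) (rep Y (shift x)) g)"
    by (simp add: T_op_def ae_class_def)
  then have "AE x in M. hinner K (\<xi> x) (\<eta> x) = 0"
    using AE_space
  proof eventually_elim
    case (elim x)
    show ?case
    proof (cases "x 0 = i")
      case True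
      then show ?thesis using supp[OF elim(2) True] K.inner_zero_left[OF sq_int_carrier[OF \<eta>(1) elim(2)]] by (simp only:)
    next
      case False
      then have "\<eta> x = hzero K" using elim by (simp add: ell2_sel)
      then show ?thesis using elim K.inner_zero_right sq_int_carrier[OF \<xi>] by simp
    qed
  qed
  then have "(\<integral>x. hinner K (\<xi> x) (\<eta> x) \<partial>M) = (\<integral>x. 0 \<partial>M)"
    using \<xi> \<eta> by (intro integral_cong_AE) (auto simp: sq_int_iff weakly_measurable_inner)
  then show ?thesis by (simp add: \<eta>(2) big_space_eq L2_inner[OF \<xi> \<eta>(1)])
qed

end

section \<open>The representation of the Cuntz algebra\<close>

locale cuntz_bernoulli_rep = bernoulli_space +
  fixes s :: "nat \<Rightarrow> 'a::cstar_algebra" and \<pi> :: "'a \<Rightarrow> vec \<Rightarrow> vec"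
  assumes gens: "cuntz_generators d s"
    and rep: "representation H \<pi>"
    and \<pi>_gen: "\<And>i \<xi>. \<lbrakk>i \<in> {1..d}; \<xi> \<in> hcarrier H\<rbrakk> \<Longrightarrow> \<pi> (s i) \<xi> = T_op d p i \<xi>"
begin

section \<open>Consequences of the representation axioms and the Cuntz relations\<close>

lemma \<pi>_closed: "x \<in> hcarrier H \<Longrightarrow> \<pi> a x \<in> hcarrier H"
  and \<pi>_vec_add: "\<lbrakk>x \<in> hcarrier H; y \<in> hcarrier H\<rbrakk> \<Longrightarrow> \<pi> a (hadd H x y) = hadd H (\<pi> a x) (\<pi> a y)"
  and \<pi>_vec_scale: "x \<in> hcarrier H \<Longrightarrow> \<pi> a (hscale H c x) = hscale H c (\<pi> a x)"
  and \<pi>_one: "x \<in> hcarrier H \<Longrightarrow> \<pi> 1 x = x"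
  and \<pi>_add: "x \<in> hcarrier H \<Longrightarrow> \<pi> (a + b) x = hadd H (\<pi> a x) (\<pi> b x)"
  and \<pi>_scale: "x \<in> hcarrier H \<Longrightarrow> \<pi> (scaleC c a) x = hscale H c (\<pi> a x)"
  and \<pi>_mult: "x \<in> hcarrier H \<Longrightarrow> \<pi> (a * b) x = \<pi> a (\<pi> b x)"
  and \<pi>_adj: "\<lbrakk>x \<in> hcarrier H; y \<in> hcarrier H\<rbrakk> \<Longrightarrow> hinner H (\<pi> (adj a) x) y = hinner H x (\<pi> a y)"
  using rep by (simp_all add: representation_def hbounded_op_def hlinear_def)

lemma \<pi>_zero: "x \<in> hcarrier H \<Longrightarrow> \<pi> 0 x = hzero H"
  using \<pi>_scale[of x 0 1] \<pi>_one[of x] big.scale_zero_eq[of x] scaleC_of_real[of 0 "1 :: 'a"] by simp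

lemma adj_mult_gen: "\<lbrakk>i \<in> {1..d}\<rbrakk> \<Longrightarrow> adj (s i) * s i = 1"
  using gens by (simp add: cuntz_generators_def)

lemma adj_mult_word:
  assumes "\<alpha> \<in> lists {1..d}"
  shows "adj (multi_prod s \<alpha>) * multi_prod s \<alpha> = 1"
  using assms
proof induction
  case (Cons i \<alpha>)
  have "adj (multi_prod s (i # \<alpha>)) * multi_prod s (i # \<alpha>) =
      adj (multi_prod s \<alpha>) * (adj (s i) * s i) * multi_prod s \<alpha>"
    by (simp add: adj_mult mult.assoc)
  then show ?case using Cons adj_mult_gen by simp
qed simp

lemma \<pi>_word_isometry:
  assumes "\<alpha> \<in> lists {1..d}" and x: "x \<in> hcarrier H"
  shows "hnorm H (\<pi> (multi_prod s \<alpha>) x) = hnorm H x"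
proof -
  have "hinner H (\<pi> (multi_prod s \<alpha>) x) (\<pi> (multi_prod s \<alpha>) x) =
      hinner H (\<pi> (adj (multi_prod s \<alpha>) * multi_prod s \<alpha>) x) x"
    using x by (simp add: \<pi>_mult \<pi>_adj \<pi>_closed)
  also have "\<dots> = hinner H x x" using x assms(1) by (simp only: adj_mult_word \<pi>_one)
  finally show ?thesis by (simp add: hnorm_def)
qed

text \<open>The value at \<open>adj a * a\<close> is the squared norm of \<open>\<pi> a x\<close>.
  Continuity of the vector state and contractivity of \<open>\<pi>\<close> both rest on
  this.\<close>

lemma positive_functional_vector:
  assumes x: "x \<in> hcarrier H"
  shows "positive_functional (\<lambda>a. hinner H x (\<pi> a x))"
  unfolding positive_functional_def
proof (intro conjI allI)
  show "hinner H x (\<pi> (a + b) x) = hinner H x (\<pi> a x) + hinner H x (\<pi> b x)" for a b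
    using x by (simp add: \<pi>_add big.inner_add_right \<pi>_closed)
  show "hinner H x (\<pi> (scaleC c a) x) = c * hinner H x (\<pi> a x)" for c a
    using x by (simp add: \<pi>_scale big.inner_scale_right \<pi>_closed)
  have "hinner H x (\<pi> (adj a * a) x) = hinner H (\<pi> a x) (\<pi> a x)" for a
    using \<pi>_adj[of x "\<pi> a x" "adj a"] x by (simp add: adj_adj \<pi>_mult \<pi>_closed)
  then show "Im (hinner H x (\<pi> (adj a * a) x)) = 0" "0 \<le> Re (hinner H x (\<pi> (adj a * a) x))" for a
    using x by (simp_all add: big.inner_self \<pi>_closed)
qed

text \<open>\<open>representation\<close> bounds each operator separately, without relating the
  bound to the norm of \<open>a\<close>. The present estimate makes a \<mapsto>
  \<open>\<pi> a x\<close> continuous, as the density argument requires.\<close>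

lemma \<pi>_contractive:
  assumes x: "x \<in> hcarrier H"
  shows "hnorm H (\<pi> a x) \<le> norm a * hnorm H x"
proof (rule power2_le_imp_le)
  have "hinner H x (\<pi> (adj a * a) x) = hinner H (\<pi> a x) (\<pi> a x)"
    using \<pi>_adj[of x "\<pi> a x" "adj a"] x by (simp add: adj_adj \<pi>_mult \<pi>_closed)
  then show "(hnorm H (\<pi> a x))\<^sup>2 \<le> (norm a * hnorm H x)\<^sup>2"
    using positive_functional_adj_mult_le[OF positive_functional_vector[OF x], of a] x
    by (simp add: big.hnorm_sq \<pi>_closed \<pi>_one power_mult_distrib)
qed (use x in \<open>simp add: big.hnorm_nonneg\<close>)

text \<open>Here \<open>u\<close>, the part of \<open>1 \<otimes> \<xi>\<^sub>h\<close> supported on \<open>x\<^sub>1 \<noteq> i\<close>, is killed by \<open>T\<^sub>i\<^sup>*\<close>, and the rest is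
  \<open>T\<^sub>i\<close> of the asserted vector, so no formula for \<open>T\<^sub>i\<^sup>*\<close> is needed.\<close>

lemma \<pi>_adj_gen:
  assumes i: "i \<in> {1..d}" and h: "h \<in> carrier (Fd d)"
  shows "\<pi> (adj (s i)) (const (ket h)) =
    hscale H (complex_of_real (sqrt (p i))) (const (ket (inv\<^bsub>Fd d\<^esub> (gen i) \<otimes>\<^bsub>Fd d\<^esub> h)))"
proof -
  define k where "k = ket (inv\<^bsub>Fd d\<^esub> (gen i) \<otimes>\<^bsub>Fd d\<^esub> h)"
  define c where "c = complex_of_real (sqrt (p i))"
  define A where "A = {x \<in> space M. x 0 \<noteq> i}"
  define \<xi> where "\<xi> x = (if x \<in> A then ket h else hzero K)" for x
  define u where "u = cl \<xi>"
  have gi: "gen i \<in> carrier (Fd d)" using i by (rule gen_carrier)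
  have kh: "ket h \<in> hcarrier K" "k \<in> hcarrier K"
    using h gi by (simp_all add: k_def ket_carrier)
  have b: "const k \<in> hcarrier H" by (rule const_carrier[OF kh(2)])
  have "A = space M - {x \<in> space M. x 0 = i}" by (auto simp: A_def)
  then have A: "A \<in> sets M" using first_letter_measurable by simp
  have \<xi>: "\<xi> \<in> sq_int M K" unfolding \<xi>_def by (rule const_if_sq_int[OF kh(1) A])
  then have u: "u \<in> hcarrier H" by (simp add: u_def big_space_eq L2_carrierI)
  have "left_reg (Fd d) (gen i) k = ket h"
    unfolding k_def using gi h by (simp add: left_reg_ket G.is_group G.inv_solve_left flip: G.m_assoc)
  then have Tb: "\<pi> (s i) (const k) = cl (\<lambda>x g. of_real (p i powr (-1/2)) * (if x 0 = i then 1 else 0) * ket h g)"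
    using \<pi>_gen[OF i b] T_op_const[OF kh(2), of i] by simp
  \<comment> \<open>T_i (1 \<otimes> k) rewritten as a scaled cutoff of a constant, a form in which
    square integrability is immediate.\<close>
  define \<zeta> where "\<zeta> = (\<lambda>x. hscale K (of_real (p i powr (-1/2))) (if x \<in> space M - A then ket h else hzero K))"
  have \<zeta>: "\<pi> (s i) (const k) = cl \<zeta>"
    unfolding Tb by (rule cl_eqI) (auto simp: \<zeta>_def A_def ell2_sel)
  have \<zeta>sq: "\<zeta> \<in> sq_int M K"
    unfolding \<zeta>_def using A by (intro sq_int_scale const_if_sq_int[OF kh(1)]) auto
  \<comment> \<open>\<open>c\<close> cancels the normalization of T_i: scaled by it, T_i (1
    \<otimes> k) is \<open>ket h\<close> on the sequences that begin with i, and \<open>u\<close>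
    supplies the others.\<close>
  have "c * of_real (p i powr (-1/2)) = 1"
    using p_pos[OF i] by (simp add: c_def powr_minus powr_half_sqrt flip: of_real_mult)
  then have "const (ket h) = hadd H (hscale H c (\<pi> (s i) (const k))) u"
    unfolding \<zeta> unfolding u_def big_space_eq const_def
    by (simp add: L2_scale L2_add \<zeta>sq \<xi> sq_int_scale)
      (rule cl_eqI, auto simp: \<xi>_def \<zeta>_def fun_eq_iff ell2_sel mult.assoc[symmetric])
  moreover have "\<pi> (adj (s i)) u = hzero H"
  proof (rule big.inner_definite)
    let ?y = "\<pi> (adj (s i)) u"
    show y: "?y \<in> hcarrier H" using u by (rule \<pi>_closed)
    \<comment> \<open>The squared norm of T_i^* u is the inner product of u with T_i T_i^* u, and
      the supports of these two are disjoint.\<close>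
    have "hinner H ?y ?y = hinner H u (T_op d p i ?y)"
      using \<pi>_adj[OF u y] \<pi>_gen[OF i y] by simp
    also have "\<dots> = 0"
      unfolding u_def
      by (rule T_op_orthogonal[OF _ \<xi>])
        (use \<pi>_gen[OF i y] \<pi>_closed[OF y, of "s i"] in \<open>simp_all add: u_def \<xi>_def A_def\<close>)
    finally show "hinner H ?y ?y = 0" .
  qed
  moreover have "\<pi> (adj (s i)) (\<pi> (s i) (const k)) = const k"
    using b adj_mult_gen[OF i] \<pi>_one by (simp flip: \<pi>_mult)
  ultimately show ?thesis
    using u b by (simp add: \<pi>_vec_add \<pi>_vec_scale \<pi>_closed big.scale_closed big.add_zero flip: k_def c_def)
qed

text \<open>Adjoints reverse a word of the algebra and inversion reverses a word of the group, so on
  both sides the first letter acts first. The basis vector \<open>h\<close> is arbitrary because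
  each step of the induction changes it.\<close>

lemma \<pi>_adj_word:
  assumes "\<gamma> \<in> lists {1..d}" "h \<in> carrier (Fd d)"
  shows "\<pi> (adj (multi_prod s \<gamma>)) (const (ket h)) =
    hscale H (complex_of_real (sqrt (multi_prod p \<gamma>))) (const (ket (inv\<^bsub>Fd d\<^esub> (gword d \<gamma>) \<otimes>\<^bsub>Fd d\<^esub> h)))"
  using assms
proof (induction arbitrary: h)
  case Nil
  then show ?case
    by (simp add: gword_Nil \<pi>_one big.scale_one const_carrier ket_carrier)
next
  case (Cons i \<gamma>)
  let ?h = "inv\<^bsub>Fd d\<^esub> (gen i) \<otimes>\<^bsub>Fd d\<^esub> h"
  have gi: "gen i \<in> carrier (Fd d)" using Cons by (intro gen_carrier)
  then have h': "?h \<in> carrier (Fd d)" using Cons by simp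
  have g\<gamma>: "gword d \<gamma> \<in> carrier (Fd d)" using Cons by (intro gword_carrier)
  have hC: "const (ket h) \<in> hcarrier H" if "h \<in> carrier (Fd d)" for h
    using that by (intro const_carrier ket_carrier)
  have "\<pi> (adj (multi_prod s (i # \<gamma>))) (const (ket h)) =
      \<pi> (adj (multi_prod s \<gamma>)) (\<pi> (adj (s i)) (const (ket h)))"
    using hC[OF Cons.prems] by (simp add: adj_mult \<pi>_mult)
  also have "\<dots> = hscale H (complex_of_real (sqrt (p i))) (\<pi> (adj (multi_prod s \<gamma>)) (const (ket ?h)))"
    using Cons.hyps(1) Cons.prems hC[OF h'] by (simp add: \<pi>_adj_gen \<pi>_vec_scale)
  also have "\<dots> = hscale H (complex_of_real (sqrt (multi_prod p (i # \<gamma>))))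
      (const (ket (inv\<^bsub>Fd d\<^esub> (gword d \<gamma>) \<otimes>\<^bsub>Fd d\<^esub> ?h)))"
    using g\<gamma> h' by (simp add: Cons.IH big.scale_scale hC real_sqrt_mult)
  also have "inv\<^bsub>Fd d\<^esub> (gword d \<gamma>) \<otimes>\<^bsub>Fd d\<^esub> ?h = inv\<^bsub>Fd d\<^esub> (gword d (i # \<gamma>)) \<otimes>\<^bsub>Fd d\<^esub> h"
    using g\<gamma> gi Cons.prems by (simp add: gword_Cons G.inv_mult_group G.m_assoc)
  finally show ?case .
qed

section \<open>The cyclic vector and its state\<close>

abbreviation \<Omega> where "\<Omega> \<equiv> Omega0 d p"

lemma \<Omega>_eq: "\<Omega> = const (ket \<one>\<^bsub>Fd d\<^esub>)"
  by (simp add: Omega0_def const_def)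

lemma \<Omega>_carrier: "\<Omega> \<in> hcarrier H"
  by (simp add: \<Omega>_eq const_carrier ket_carrier)

lemma \<pi>_adj_word_\<Omega>:
  assumes "\<gamma> \<in> lists {1..d}"
  shows "\<pi> (adj (multi_prod s \<gamma>)) \<Omega> =
    hscale H (complex_of_real (sqrt (multi_prod p \<gamma>))) (const (ket (inv\<^bsub>Fd d\<^esub> (gword d \<gamma>))))"
  using \<pi>_adj_word[OF assms, of "\<one>\<^bsub>Fd d\<^esub>"] gword_carrier[OF assms] by (simp add: \<Omega>_eq)

lemma multi_prod_p_pos: "\<gamma> \<in> lists {1..d} \<Longrightarrow> 0 < multi_prod p \<gamma>"
  by (induction rule: lists.induct) (simp_all add: p_pos)

text \<open>With s_\<alpha> moved to the other side, two multiples of basis vectors at inverses of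
  group words remain. Distinct words give orthogonal vectors, and for equal words the two square
  roots multiply to p^\<alpha>.\<close>

lemma vector_state_word:
  assumes \<alpha>: "\<alpha> \<in> lists {1..d}" and \<gamma>: "\<gamma> \<in> lists {1..d}"
  shows "hinner H \<Omega> (\<pi> (multi_prod s \<alpha> * adj (multi_prod s \<gamma>)) \<Omega>) =
    (if \<alpha> = \<gamma> then complex_of_real (multi_prod p \<alpha>) else 0)"
proof -
  let ?k = "\<lambda>\<gamma>. ket (inv\<^bsub>Fd d\<^esub> (gword d \<gamma>))"
  have k: "?k \<alpha> \<in> hcarrier K" "?k \<gamma> \<in> hcarrier K"
    using assms by (auto intro!: ket_carrier G.inv_closed gword_carrier)
  have "hinner H \<Omega> (\<pi> (multi_prod s \<alpha> * adj (multi_prod s \<gamma>)) \<Omega>) =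
      hinner H (\<pi> (adj (multi_prod s \<alpha>)) \<Omega>) (\<pi> (adj (multi_prod s \<gamma>)) \<Omega>)"
    by (simp add: \<pi>_mult \<pi>_adj \<Omega>_carrier \<pi>_closed)
  also have "\<dots> = complex_of_real (sqrt (multi_prod p \<alpha>)) * (complex_of_real (sqrt (multi_prod p \<gamma>)) *
      hinner K (?k \<alpha>) (?k \<gamma>))"
    using k const_carrier by (simp add: \<pi>_adj_word_\<Omega> \<alpha> \<gamma> big.inner_scale_left big.inner_scale_right
        big.scale_closed const_inner)
  also have "hinner K (?k \<alpha>) (?k \<gamma>) = (if \<alpha> = \<gamma> then 1 else 0)"
  proof -
    have "inv\<^bsub>Fd d\<^esub> (gword d \<alpha>) = inv\<^bsub>Fd d\<^esub> (gword d \<gamma>) \<longleftrightarrow> \<alpha> = \<gamma>"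
      using gword_carrier[OF \<alpha>] gword_carrier[OF \<gamma>] inj_gword[of d \<alpha> \<gamma>] by (metis G.inv_inv)
    then show ?thesis
      using gword_carrier[OF \<alpha>] by (simp add: ell2_inner_ket) (simp add: ket_def)
  qed
  finally show ?thesis
    using multi_prod_p_pos[OF \<alpha>] by (auto simp flip: of_real_mult)
qed

lemma state_eq_vector_state:
  assumes "is_state \<omega>"
    and "\<And>\<alpha> \<gamma>. \<lbrakk>\<alpha> \<in> lists {1..d}; \<gamma> \<in> lists {1..d}\<rbrakk> \<Longrightarrow>
           \<omega> (multi_prod s \<alpha> * adj (multi_prod s \<gamma>)) =
             (if \<alpha> = \<gamma> then complex_of_real (multi_prod p \<alpha>) else 0)"
  shows "\<omega> a = hinner H \<Omega> (\<pi> a \<Omega>)"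
proof -
  have pos: "positive_functional \<omega>" "positive_functional (\<lambda>a. hinner H \<Omega> (\<pi> a \<Omega>))"
    using assms(1) positive_functional_vector[OF \<Omega>_carrier]
    by (simp_all add: is_state_def positive_functional_def)
  note bl = pos[THEN positive_functional_bounded_linear]
  have "a \<in> {a. \<omega> a = hinner H \<Omega> (\<pi> a \<Omega>)}"
  proof (rule cuntz_words_induct[OF gens])
    show "closed {a. \<omega> a = hinner H \<Omega> (\<pi> a \<Omega>)}"
      using bl by (intro closed_Collect_eq linear_continuous_on)
    show "0 \<in> {a. \<omega> a = hinner H \<Omega> (\<pi> a \<Omega>)}"
      using bl[THEN bounded_linear.linear, THEN linear_0] by simp
  qed (use pos assms(2) vector_state_word in \<open>simp_all add: positive_functional_def\<close>)
  then show ?thesis by simp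
qed

section \<open>The fibers and the cyclic space\<close>

definition fiber_map :: "nat list \<Rightarrow> (nat fword \<Rightarrow> complex) \<Rightarrow> vec" where
  "fiber_map \<alpha> k = \<pi> (multi_prod s \<alpha>) (const k)"

lemma fiber_map_isometry:
  assumes "\<alpha> \<in> lists {1..d}"
  shows "hisometry K H (fiber_map \<alpha>)"
  using const_isometry const_carrier assms unfolding hisometry_def hlinear_def fiber_map_def
  by (simp add: \<pi>_closed \<pi>_vec_add \<pi>_vec_scale \<pi>_word_isometry)

lemma fiber_map_ket:
  assumes "\<alpha> \<in> lists {1..d}" "\<gamma> \<in> lists {1..d}"
  shows "\<pi> (multi_prod s \<alpha> * adj (multi_prod s \<gamma>)) \<Omega> =
    hscale H (complex_of_real (sqrt (multi_prod p \<gamma>))) (fiber_map \<alpha> (ket (inv\<^bsub>Fd d\<^esub> (gword d \<gamma>))))"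
  using assms gword_carrier[OF assms(2)]
  by (simp add: \<pi>_mult \<Omega>_carrier \<pi>_adj_word_\<Omega> fiber_map_def \<pi>_vec_scale const_carrier ket_carrier)

text \<open>The generators of H_-: left translation by t takes the basis vector at the neutral
  element to the one at t.\<close>

definition minus_kets :: "(nat fword \<Rightarrow> complex) set" where
  "minus_kets = (\<lambda>\<gamma>. ket (inv\<^bsub>Fd d\<^esub> (gword d \<gamma>))) ` lists {1..d}"

lemma H_minus_eq: "H_minus d = hrestrict K (closed_span K minus_kets)"
proof -
  have "{left_reg (Fd d) (inv\<^bsub>Fd d\<^esub> t) (ket \<one>\<^bsub>Fd d\<^esub>) | t. t \<in> free_semigroup d} =
      (\<lambda>t. left_reg (Fd d) (inv\<^bsub>Fd d\<^esub> t) (ket \<one>\<^bsub>Fd d\<^esub>)) ` gword d ` lists {1..d}"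
    unfolding free_semigroup_def by blast
  also have "\<dots> = minus_kets"
    unfolding minus_kets_def image_image
    by (intro image_cong refl) (use gword_carrier in \<open>simp add: left_reg_ket G.is_group\<close>)
  finally show ?thesis by (simp add: H_minus_def)
qed

lemma minus_kets_carrier: "minus_kets \<subseteq> hcarrier K"
  unfolding minus_kets_def using gword_carrier by (auto intro!: ket_carrier)

text \<open>Two closed subspaces \<open>C\<close> and \<open>D\<close> of the ambient space are
  compared, each inclusion being tested on generators: the fibers on the basis vectors of H_-, the
  orbit on the words of the algebra. The result is then transported into the restricted
  spaces.\<close>

lemma cyclic_space_fibered:
  "fibered_over (cyclic_space H \<pi> \<Omega>) (lists {1..d}) (H_minus d)"
proof -
  define C where "C = closed_span H {\<pi> a \<Omega> | a. True}"
  define W where "W = closed_span K minus_kets"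
  define U where "U = (\<Union>\<alpha>\<in>lists {1..d}. fiber_map \<alpha> ` W)"
  have orbit: "{\<pi> a \<Omega> | a. True} \<subseteq> hcarrier H" using \<pi>_closed[OF \<Omega>_carrier] by auto
  have C: "hsubspace H C" "hclosure H C \<subseteq> C" "{\<pi> a \<Omega> | a. True} \<subseteq> C"
    unfolding C_def using orbit
    by (rule big.closed_span_subspace big.closed_span_closed big.closed_span_superset)+
  have W: "hsubspace K W" "hclosure K W \<subseteq> W" "minus_kets \<subseteq> W"
    unfolding W_def using minus_kets_carrier
    by (rule K.closed_span_subspace K.closed_span_closed K.closed_span_superset)+
  have WK: "W \<subseteq> hcarrier K" using W(1) by (simp add: hsubspace_def)
  have iso: "hisometry K H (fiber_map \<alpha>)" if "\<alpha> \<in> lists {1..d}" for \<alpha>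
    using that by (rule fiber_map_isometry)
  have into: "fiber_map \<alpha> k \<in> C" if \<alpha>: "\<alpha> \<in> lists {1..d}" and "k \<in> W" for \<alpha> k
  proof -
    \<comment> \<open>By \<open>pre\<close> the vectors sent into \<open>C\<close> form a closed
      subspace, so it is enough to check the basis vectors.\<close>
    note pre = hlinear_isometry_preimage[OF big.complex_hilbert_space_axioms hilbert iso[OF \<alpha>] C(1,2)]
    have "W \<subseteq> {k \<in> hcarrier K. fiber_map \<alpha> k \<in> C}"
      unfolding W_def
    proof (rule K.closed_span_minimal[OF pre], rule subsetI)
      fix k assume k: "k \<in> minus_kets"
      then obtain \<gamma> where \<gamma>: "\<gamma> \<in> lists {1..d}" "k = ket (inv\<^bsub>Fd d\<^esub> (gword d \<gamma>))"
        by (auto simp: minus_kets_def)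
      have kK: "k \<in> hcarrier K" using k minus_kets_carrier by blast
      let ?c = "complex_of_real (sqrt (multi_prod p \<gamma>))"
      \<comment> \<open>Positive weights make the scalar invertible, so \<open>fiber_map_ket\<close>
        can be solved for the fiber vector.\<close>
      have c: "?c \<noteq> 0" using multi_prod_p_pos[OF \<gamma>(1)] by simp
      have "fiber_map \<alpha> k \<in> hcarrier H" by (simp add: fiber_map_def \<pi>_closed const_carrier kK)
      then have "fiber_map \<alpha> k = hscale H (1 / ?c) (\<pi> (multi_prod s \<alpha> * adj (multi_prod s \<gamma>)) \<Omega>)"
        using c by (simp add: fiber_map_ket[OF \<alpha> \<gamma>(1)] big.scale_scale big.scale_one flip: \<gamma>(2))
      moreover have "\<pi> (multi_prod s \<alpha> * adj (multi_prod s \<gamma>)) \<Omega> \<in> C" using C(3) by blast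
      then have "hscale H (1 / ?c) (\<pi> (multi_prod s \<alpha> * adj (multi_prod s \<gamma>)) \<Omega>) \<in> C"
        using C(1) unfolding hsubspace_def by blast
      ultimately show "k \<in> {k \<in> hcarrier K. fiber_map \<alpha> k \<in> C}" using kK by simp
    qed
    then show ?thesis using \<open>k \<in> W\<close> by auto
  qed
  have UC: "U \<subseteq> C" unfolding U_def using into by blast
  then have UH: "U \<subseteq> hcarrier H" using C(1) by (auto simp: hsubspace_def)
  define D where "D = closed_span H U"
  have D: "hsubspace H D" "hclosure H D \<subseteq> D" "U \<subseteq> D"
    unfolding D_def using UH
    by (rule big.closed_span_subspace big.closed_span_closed big.closed_span_superset)+
  have "D \<subseteq> C" unfolding D_def by (rule big.closed_span_minimal[OF C(1,2) UC])
  moreover have "\<pi> a \<Omega> \<in> D" for a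
  proof -
    have "a \<in> {a. \<pi> a \<Omega> \<in> D}"
    proof (rule cuntz_words_induct[OF gens])
      show "closed {a. \<pi> a \<Omega> \<in> D}"
        unfolding closed_sequential_limits
      proof (intro allI impI, elim conjE)
        fix X a assume X: "\<forall>n. X n \<in> {a. \<pi> a \<Omega> \<in> D}" "X \<longlonglongrightarrow> a"
        \<comment> \<open>Contractivity turns norm convergence in the algebra into convergence of
          orbit vectors, whose limit stays in the closed subspace \<open>D\<close>.\<close>
        have le: "hdist H (\<pi> a \<Omega>) (\<pi> b \<Omega>) \<le> norm (a - b) * hnorm H \<Omega>" for b
        proof -
          have "a - b = a + scaleC (-1) b" using scaleC_of_real[of "-1" b] by simp
          then have "\<pi> (a - b) \<Omega> = hadd H (\<pi> a \<Omega>) (hscale H (-1) (\<pi> b \<Omega>))"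
            by (simp only: \<pi>_add \<pi>_scale \<Omega>_carrier)
          then show ?thesis using \<pi>_contractive[OF \<Omega>_carrier, of "a - b"] by (simp add: hdist_def)
        qed
        have "\<pi> a \<Omega> \<in> hclosure H D"
          unfolding hclosure_def
        proof (intro CollectI conjI allI impI)
          show "\<pi> a \<Omega> \<in> hcarrier H" by (rule \<pi>_closed[OF \<Omega>_carrier])
          fix e :: real assume "e > 0"
          have "(\<lambda>n. norm (a - X n) * hnorm H \<Omega>) \<longlonglongrightarrow> norm (a - a) * hnorm H \<Omega>"
            by (intro tendsto_intros X(2))
          then have "\<forall>\<^sub>F n in sequentially. norm (a - X n) * hnorm H \<Omega> < e"
            using \<open>e > 0\<close> by (intro order_tendstoD(2)) auto
          then obtain n where "norm (a - X n) * hnorm H \<Omega> < e"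
            by (meson eventually_sequentially order_refl)
          then show "\<exists>y\<in>D. hdist H (\<pi> a \<Omega>) y < e"
            using X(1) le[of "X n"] by (intro bexI[of _ "\<pi> (X n) \<Omega>"]) auto
        qed
        then show "a \<in> {a. \<pi> a \<Omega> \<in> D}" using D(2) by auto
      qed
      show "0 \<in> {a. \<pi> a \<Omega> \<in> D}" using D(1) by (simp add: \<pi>_zero \<Omega>_carrier hsubspace_def)
      fix \<alpha> \<gamma> assume \<alpha>: "\<alpha> \<in> lists {1..d}" and \<gamma>: "\<gamma> \<in> lists {1..d}"
      have "fiber_map \<alpha> (ket (inv\<^bsub>Fd d\<^esub> (gword d \<gamma>))) \<in> U"
        using \<alpha> \<gamma> W(3) unfolding U_def minus_kets_def by blast
      then show "multi_prod s \<alpha> * adj (multi_prod s \<gamma>) \<in> {a. \<pi> a \<Omega> \<in> D}"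
        using D by (auto simp: fiber_map_ket[OF \<alpha> \<gamma>] hsubspace_def)
    qed (use D(1) in \<open>auto simp: \<pi>_add \<pi>_scale \<Omega>_carrier hsubspace_def\<close>)
    then show ?thesis by simp
  qed
  then have "C \<subseteq> D" unfolding C_def using D(1,2) by (intro big.closed_span_minimal) auto
  ultimately have "C = D" by blast
  \<comment> \<open>The closed span has so far been taken in \<open>H\<close>; the definition of a
    fibered space asks for the one relative to \<open>C\<close>.\<close>
  then have span: "C = closed_span (hrestrict H C) U"
    using big.closed_span_hrestrict[OF C(1,2) UC] by (simp add: D_def)
  \<comment> \<open>Norms and operations are unchanged by restriction; what makes the restricted map
    well defined is \<open>into\<close>.\<close>
  have "hisometry (hrestrict K W) (hrestrict H C) (fiber_map \<alpha>)" if "\<alpha> \<in> lists {1..d}" for \<alpha>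
    using iso[OF that] into[OF that] WK
    by (auto simp: hisometry_def hlinear_def hrestrict_def hnorm_def subset_iff)
  then show ?thesis
    unfolding fibered_over_def H_minus_eq cyclic_space_def C_def[symmetric] W_def[symmetric]
    using big.hrestrict_hilbert[OF C(1,2)] K.hrestrict_hilbert[OF W(1,2)] span
    by (intro conjI exI[of _ fiber_map]) (auto simp: U_def hrestrict_def)
qed

end

theorem mainTheorem3:
  fixes d :: nat
    and p :: "nat \<Rightarrow> real"
    and s :: "nat \<Rightarrow> 'a::cstar_algebra"
    and \<omega> :: "'a \<Rightarrow> complex"
    and \<pi> :: "'a \<Rightarrow> vec \<Rightarrow> vec"
  assumes "2 \<le> d"
    and "\<And>i. i \<in> {1..d} \<Longrightarrow> 0 < p i"
    and "(\<Sum>i=1..d. p i) = 1"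
    and "cuntz_generators d s"
    and "is_state \<omega>"
    and "\<And>\<alpha> \<gamma>. \<lbrakk>\<alpha> \<in> lists {1..d}; \<gamma> \<in> lists {1..d}\<rbrakk> \<Longrightarrow>
           \<omega> (multi_prod s \<alpha> * adj (multi_prod s \<gamma>)) =
             (if \<alpha> = \<gamma> then complex_of_real (multi_prod p \<alpha>) else 0)"
    and "representation (big_space d p) \<pi>"
    and "\<And>i \<xi>. \<lbrakk>i \<in> {1..d}; \<xi> \<in> hcarrier (big_space d p)\<rbrakk> \<Longrightarrow> \<pi> (s i) \<xi> = T_op d p i \<xi>"
  shows "(\<forall>a. \<omega> a = hinner (big_space d p) (Omega0 d p) (\<pi> a (Omega0 d p))) \<and>
         fibered_over (cyclic_space (big_space d p) \<pi> (Omega0 d p)) (lists {1..d}) (H_minus d)"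
proof -
  interpret cuntz_bernoulli_rep d p s \<pi>
    by unfold_locales (use assms in blast)+
  show ?thesis
    using state_eq_vector_state[OF assms(5,6)] cyclic_space_fibered by blast
qed

end
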